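(* The set $\{R_0,\dots,R_n,U_1,\dots,U_n\}$ (with $R_m=R_m(z;\mathbf t\,|\,q)$, $U_m=U_m(z;\mathbf t\,|\,q)$) is an orthogonal basis for $V_n$ with respect to the symmetric bilinear form $\langle\cdot,\cdot\rangle_{\rm cher}$. Moreover, $\langle R_m,R_m\rangle_{\rm cher}$ and $\langle U_m,U_m\rangle_{\rm cher}$ are non-zero (for the members $R_m$, $0\le m\le n$, and $U_m$, $1\le m\le n$, of this set).
   Context: Standing assumptions: $0<q<1$; $\mathbf t=(t_1,t_2,t_3,t_4)$ with each $t_i$ real and $|t_i|<1$; $n\ge 0$ is an integer. Notation: $(a;q)_k=\prod_{i=0}^{k-1}(1-aq^i)$, $(a;q)_\infty=\prod_{i\ge0}(1-aq^i)$, $(a_1,\dots,a_r;q)_k=\prod_j(a_j;q)_k$, and ${}_4\phi_3(a_1,a_2,a_3,a_4;b_1,b_2,b_3;q,q)=\sum_{k\ge 0}\frac{(a_1,a_2,a_3,a_4;q)_k}{(q,b_1,b_2,b_3;q)_k}q^k$. $V_n$ is the $(2n+1)$-dimensional real vector space of Laurent polynomials spanned by $z^{-n},z^{1-n},\dots,z^{n}$. $R_n(z;\mathbf t\,|\,q)={}_4\phi_3(q^{-n},t_1t_2t_3t_4q^{n-1},t_1z,t_1/z;\;t_1t_2,t_1t_3,t_1t_4;q,q)$. For $n\ge1$, $U_n(z;\mathbf t\,|\,q)=\frac1z(1-t_1z)(1-t_2z)\,R_{n-1}(z;qt_1,qt_2,t_3,t_4\,|\,q)$. $w_{\rm cher}(z;\mathbf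 t\,|\,q)=\dfrac{(q,z^2,qz^{-2};q)_\infty}{\prod_{j=1}^4(t_jz;q)_\infty\,(t_3/z,t_4/z,qt_1/z,qt_2/z;q)_\infty}$ and, for Laurent polynomials $f,g$, $\langle f,g\rangle_{\rm cher}=\frac1{2\pi i}\oint_{|z|=1}f(z)g(z)\,w_{\rm cher}(z;\mathbf t\,|\,q)\,\frac{dz}{z}$. "Orthogonal basis" means a basis whose distinct elements are pairwise orthogonal for this form.
   Formalization: The formal theorem additionally assumes t_1 ≠ 0 or n = 0; for t_1 = 0 and n ≥ 1 the polynomial R_1 vanishes identically, so the set contains 0, is not a basis, and ⟨R_1,R_1⟩ = 0. *)

theory Defs
  imports "HOL-Complex_Analysis.Complex_Analysis"
begin

section \<open>Real scalars on formal Laurent series\<close>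

text \<open>
  Laurent polynomials are elements of the field \<open>complex fls\<close>. The real vector space structure
  below makes \<open>span\<close> and \<open>independent\<close> refer to linear combinations with real coefficients,
  and \<open>of_real r\<close> the constant Laurent polynomial \<open>r\<close>.
\<close>

instantiation fls :: (real_field) real_field
begin

definition scaleR_fls :: "real \<Rightarrow> 'a fls \<Rightarrow> 'a fls" where
  "scaleR_fls c f = fls_const (of_real c) * f"

instance
proof
  fix a b :: real and x y :: "'a fls"
  show "a *\<^sub>R (x + y) = a *\<^sub>R x + a *\<^sub>R y"
    by (simp add: scaleR_fls_def distrib_left)
  show "(a + b) *\<^sub>R x = a *\<^sub>R x + b *\<^sub>R x"
    by (simp add: scaleR_fls_def distrib_right flip: fls_plus_const)
  show "a *\<^sub>R b *\<^sub>R x = (a * b) *\<^sub>R x"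
    by (simp add: scaleR_fls_def mult.assoc flip: fls_const_mult_const)
  show "1 *\<^sub>R x = x"
    by (simp add: scaleR_fls_def)
  show "a *\<^sub>R x * y = a *\<^sub>R (x * y)"
    by (simp add: scaleR_fls_def mult.assoc)
  show "x * a *\<^sub>R y = a *\<^sub>R (x * y)"
    by (simp add: scaleR_fls_def mult.left_commute)
qed

end

lemma of_real_fls: "of_real r = fls_const (of_real r)"
  by (simp add: of_real_def[where 'a = "'a fls"] scaleR_fls_def)

text \<open>The space \<open>V\<^sub>n\<close>; \<open>fls_X_intpow k\<close> is the monomial \<open>z\<^sup>k\<close>.\<close>

definition laurent_space :: "nat \<Rightarrow> complex fls set" where
  "laurent_space n = span (fls_X_intpow ` {- int n..int n})"


section \<open>Basic hypergeometric notation\<close>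

definition qpoch :: "'a::comm_ring_1 \<Rightarrow> 'a \<Rightarrow> nat \<Rightarrow> 'a" where
  "qpoch a q k = (\<Prod>i<k. 1 - a * q ^ i)"

definition qpoch_inf :: "complex \<Rightarrow> complex \<Rightarrow> complex" where
  "qpoch_inf a q = (\<Prod>i. 1 - a * q ^ i)"

text \<open>The series \<open>\<^sub>4\<phi>\<^sub>3\<close> with base and argument both equal to \<open>q\<close>.\<close>

definition phi43 :: "'a \<Rightarrow> 'a \<Rightarrow> 'a \<Rightarrow> 'a \<Rightarrow> 'a \<Rightarrow> 'a \<Rightarrow> 'a \<Rightarrow> 'a \<Rightarrow> 'a::{field, t2_space}" where
  "phi43 a1 a2 a3 a4 b1 b2 b3 q =
     (\<Sum>k. (qpoch a1 q k * qpoch a2 q k * qpoch a3 q k * qpoch a4 q k) /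
          (qpoch q q k * qpoch b1 q k * qpoch b2 q k * qpoch b3 q k) * q ^ k)"


section \<open>The Laurent polynomials R and U\<close>

text \<open>
  The variable \<open>z\<close> ranges over an arbitrary field extension of the reals: with \<open>z = fls_X\<close> one
  obtains the Laurent polynomial itself. The series \<open>phi43\<close> then terminates, because
  \<open>qpoch (q\<^sup>-\<^sup>n) q k = 0\<close> for \<open>k > n\<close>.
\<close>

definition AW_R ::
  "real \<Rightarrow> real \<Rightarrow> real \<Rightarrow> real \<Rightarrow> real \<Rightarrow> nat \<Rightarrow> 'a \<Rightarrow> 'a::{real_field, t2_space}" where
  "AW_R q t1 t2 t3 t4 n z =
     phi43 (of_real (q powi (- int n))) (of_real (t1 * t2 * t3 * t4 * q powi (int n - 1)))
           (of_real t1 * z) (of_real t1 / z)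
           (of_real (t1 * t2)) (of_real (t1 * t3)) (of_real (t1 * t4)) (of_real q)"

text \<open>Only meaningful for \<open>n \<ge> 1\<close>.\<close>

definition AW_U ::
  "real \<Rightarrow> real \<Rightarrow> real \<Rightarrow> real \<Rightarrow> real \<Rightarrow> nat \<Rightarrow> 'a \<Rightarrow> 'a::{real_field, t2_space}" where
  "AW_U q t1 t2 t3 t4 n z =
     1 / z * (1 - of_real t1 * z) * (1 - of_real t2 * z) *
     AW_R q (q * t1) (q * t2) t3 t4 (n - 1) z"

text \<open>
  For \<open>t1 = 0\<close> the defining series degenerates: the polynomial of index 1 vanishes
  identically (as do all those of higher index), so it cannot belong to a basis.
\<close>

lemma AW_R_1_degenerate:
  fixes z :: "'a::{real_field, t2_space}"
  assumes "0 < q" "q < 1"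
  shows "AW_R q 0 t2 t3 t4 1 z = 0"
proof -
  define Q P :: 'a where "Q = of_real q" and "P = inverse Q"
  have PQ: "P * Q = 1"
    using assms by (simp add: P_def Q_def)
  have q1: "1 - Q \<noteq> 0"
    using assms by (simp add: Q_def)
  have vanish: "qpoch P Q k = 0" if "k \<notin> {..<2}" for k
    unfolding qpoch_def using that PQ by (intro prod_zero bexI[of _ 1]) auto
  have zero: "qpoch 0 Q k = 1" for k
    by (simp add: qpoch_def)
  have "AW_R q 0 t2 t3 t4 1 z = (\<Sum>k. qpoch P Q k / qpoch Q Q k * Q ^ k)"
    by (simp add: AW_R_def phi43_def zero power_int_minus flip: Q_def P_def)
  also have "\<dots> = (\<Sum>k<2. qpoch P Q k / qpoch Q Q k * Q ^ k)"
    by (intro suminf_finite) (auto simp: vanish)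
  also have "\<dots> = 1 + (1 - P) * Q / (1 - Q)"
    by (simp add: numeral_2_eq_2 qpoch_def)
  also have "(1 - P) * Q = - (1 - Q)"
    using PQ by (simp add: algebra_simps)
  finally show ?thesis
    using q1 by (simp add: divide_simps)
qed


section \<open>The bilinear form\<close>

definition w_cher :: "real \<Rightarrow> real \<Rightarrow> real \<Rightarrow> real \<Rightarrow> real \<Rightarrow> complex \<Rightarrow> complex" where
  "w_cher q t1 t2 t3 t4 z =
     (let P = (\<lambda>a. qpoch_inf a (of_real q)) in
       (P (of_real q) * P (z\<^sup>2) * P (of_real q / z\<^sup>2)) /
       ((P (of_real t1 * z) * P (of_real t2 * z) * P (of_real t3 * z) * P (of_real t4 * z)) *
        (P (of_real t3 / z) * P (of_real t4 / z) *
         P (of_real (q * t1) / z) * P (of_real (q * t2) / z))))"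

definition cher_form ::
  "real \<Rightarrow> real \<Rightarrow> real \<Rightarrow> real \<Rightarrow> real \<Rightarrow> complex fls \<Rightarrow> complex fls \<Rightarrow> complex" where
  "cher_form q t1 t2 t3 t4 f g =
     1 / (2 * of_real pi * \<i>) *
     contour_integral (circlepath 0 1)
       (\<lambda>z. eval_fls f z * eval_fls g z * w_cher q t1 t2 t3 t4 z / z)"

definition orthogonal_basis ::
  "('v::real_vector \<Rightarrow> 'v \<Rightarrow> complex) \<Rightarrow> 'v set \<Rightarrow> 'v set \<Rightarrow> bool" where
  "orthogonal_basis form V B \<longleftrightarrow>
     B \<subseteq> V \<and> independent B \<and> span B = V \<and> pairwise (\<lambda>f g. form f g = 0) B"

end

theory Submission
  imports Defs
begin

text \<open>
  Write \<open>w\<close> for the symmetric Askey--Wilson weight. For \<open>f\<close> invariant under \<open>z \<mapsto> 1/z\<close>, averaging the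
  integrand over \<open>z\<close> and \<open>1/z\<close> turns the Cherednik form into \<open>(1 - t\<^sub>1t\<^sub>2)/2\<close> times integration
  against \<open>w\<close>. The same averaging kills \<open>\<langle>R\<^sub>m, U\<^sub>k\<rangle>\<close>, whose integrand is antisymmetric, and reduces
  \<open>\<langle>U\<^sub>m, U\<^sub>k\<rangle>\<close> to the Askey--Wilson form with parameters \<open>(qt\<^sub>1, qt\<^sub>2, t\<^sub>3, t\<^sub>4)\<close>.

  Orthogonality of the \<open>R\<^sub>m\<close> with respect to \<open>w\<close> holds because they are eigenfunctions, with
  distinct eigenvalues, of the Askey--Wilson \<open>q\<close>-difference operator. That operator is self-adjoint:
  moving the contour from \<open>|z| = 1\<close> to \<open>|z| = q\<close> crosses no pole. The norms do not vanish because
  \<open>w\<close> has constant sign on the circle and \<open>R\<^sub>m(t\<^sub>1) = 1\<close>. This avoids the evaluation of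
  the Askey--Wilson integral. Finally, \<open>2n + 1\<close> orthogonal non-isotropic vectors form a basis
  of \<open>V\<^sub>n\<close>, since \<open>V\<^sub>n\<close> is spanned by \<open>2n + 1\<close> monomials.
\<close>

section \<open>Mean values over the unit circle\<close>

text \<open>The mean over the unit circle for dz/z, the measure invariant under inversion and
  dilation. The shape copies \<open>cher_form\<close>, so that the form is such a mean by
  unfolding.\<close>

definition circle_mean :: "(complex \<Rightarrow> complex) \<Rightarrow> complex" where
  "circle_mean h = 1 / (2 * of_real pi * \<i>) * contour_integral (circlepath 0 1) (\<lambda>z. h z / z)"

lemma circle_mean_conv_integral:
  "circle_mean h = integral {0..1} (\<lambda>x. h (exp (2 * of_real pi * \<i> * of_real x)))"
proof -
  have "contour_integral (circlepath 0 1) (\<lambda>z. h z / z) =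
      integral {0..1} (\<lambda>x. h (exp (2 * of_real pi * \<i> * of_real x)) * (2 * of_real pi * \<i>))"
    unfolding contour_integral_integral
    by (intro integral_cong, subst vector_derivative_circlepath) (simp add: circlepath field_simps)
  also have "\<dots> = integral {0..1} (\<lambda>x. h (exp (2 * of_real pi * \<i> * of_real x))) * (2 * of_real pi * \<i>)"
    by (rule integral_mult_left)
  finally show ?thesis by (simp add: circle_mean_def)
qed

lemma circle_mean_cong:
  assumes "\<And>z. cmod z = 1 \<Longrightarrow> f z = g z"
  shows "circle_mean f = circle_mean g"
  unfolding circle_mean_conv_integral by (intro integral_cong assms) simp

lemma circle_param_integrable:
  fixes f :: "complex \<Rightarrow> complex"
  assumes "continuous_on (sphere 0 1) f"
  shows "(\<lambda>x. f (exp (2 * of_real pi * \<i> * of_real x))) integrable_on {0..1}"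
proof -
  have "continuous_on {0..1} (\<lambda>x. f (exp (2 * of_real pi * \<i> * of_real x)))"
    by (rule continuous_on_compose2[OF assms]) (auto intro!: continuous_intros)
  thus ?thesis by (rule integrable_continuous_real)
qed

lemma circle_mean_add:
  assumes "continuous_on (sphere 0 1) f" "continuous_on (sphere 0 1) g"
  shows "circle_mean (\<lambda>z. f z + g z) = circle_mean f + circle_mean g"
  unfolding circle_mean_conv_integral by (intro integral_add circle_param_integrable assms)

lemma circle_mean_diff:
  assumes "continuous_on (sphere 0 1) f" "continuous_on (sphere 0 1) g"
  shows "circle_mean (\<lambda>z. f z - g z) = circle_mean f - circle_mean g"
  unfolding circle_mean_conv_integral by (intro integral_diff circle_param_integrable assms)

lemma circle_mean_cmult: "circle_mean (\<lambda>z. c * f z) = c * circle_mean f"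
  unfolding circle_mean_conv_integral by (rule integral_mult_right)

lemma circle_mean_reflect: 
  assumes "continuous_on (sphere 0 1) f"
  shows "circle_mean (\<lambda>z. f (1 / z)) = circle_mean f"
proof -
  let ?g = "\<lambda>x. f (exp (2 * of_real pi * \<i> * of_real x))"
  have "(?g has_integral circle_mean f) {0..1}"
    unfolding circle_mean_conv_integral using circle_param_integrable[OF assms] by (rule integrable_integral)
  hence "((\<lambda>x. ?g (1 - x)) has_integral circle_mean f) {0..1}"
    using has_integral_affinity01[of ?g "circle_mean f" "-1" 1] by (simp add: o_def)
  moreover have "?g (1 - x) = f (1 / exp (2 * of_real pi * \<i> * of_real x))" for x :: real
    by (simp add: right_diff_distrib exp_diff)
  ultimately show ?thesis
    unfolding circle_mean_conv_integral by (simp add: integral_unique)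
qed

text \<open>Substituting qz turns the mean over |z| = 1 into the integral of f(z)/z over |z| = q.
  The radial homotopy between the two circles stays in the closed annulus, where f(z)/z is
  holomorphic.\<close>

lemma circle_mean_dilate:
  fixes q :: real
  assumes q: "0 < q" "q < 1"
    and S: "open S" "\<And>z. q \<le> cmod z \<Longrightarrow> cmod z \<le> 1 \<Longrightarrow> z \<in> S"
    and f: "f holomorphic_on S"
  shows "circle_mean (\<lambda>z. f (of_real q * z)) = circle_mean f"
proof -
  have "homotopic_loops (S - {0}) (circlepath 0 q) (circlepath 0 1)"
  proof (rule homotopic_loops_linear)
    fix t :: real assume t: "t \<in> {0..1}"
    show "closed_segment (circlepath 0 q t) (circlepath 0 1 t) \<subseteq> S - {0}"
    proof
      fix z assume "z \<in> closed_segment (circlepath 0 q t) (circlepath 0 1 t)"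
      then obtain u where u: "0 \<le> u" "u \<le> 1"
        and z: "z = (1 - u) *\<^sub>R circlepath 0 q t + u *\<^sub>R circlepath 0 1 t"
        by (auto simp: closed_segment_def)
      have "z = of_real ((1 - u) * q + u) * exp (2 * of_real pi * \<i> * of_real t)"
        by (simp add: z circlepath scaleR_conv_of_real algebra_simps)
      hence "cmod z = \<bar>(1 - u) * q + u\<bar>" by (simp add: norm_mult del: of_real_add of_real_mult of_real_diff)
      moreover have "q \<le> (1 - u) * q + u" 
        using mult_nonneg_nonneg[of u "1 - q"] u q by (simp add: algebra_simps)
      moreover have "(1 - u) * q + u \<le> 1" 
        using mult_nonneg_nonneg[of "1 - u" "1 - q"] u q by (simp add: algebra_simps)
      ultimately show "z \<in> S - {0}" using S(2)[of z] q by auto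
    qed
  qed auto
  hence eq: "contour_integral (circlepath 0 q) (\<lambda>z. f z / z) = contour_integral (circlepath 0 1) (\<lambda>z. f z / z)"
    by (rule Cauchy_theorem_homotopic_loops)
      (auto intro!: holomorphic_intros open_Diff S holomorphic_on_subset[OF f])
  have "contour_integral (circlepath 0 q) (\<lambda>z. f z / z) 
      = contour_integral (circlepath 0 1) (\<lambda>z. f (of_real q * z) / z)"
    unfolding contour_integral_integral using q
    by (intro integral_cong, subst (1 2) vector_derivative_circlepath) (simp add: circlepath field_simps)
  with eq show ?thesis by (simp add: circle_mean_def)
qed

lemma circle_mean_of_real_eq_0D:
  fixes f :: "complex \<Rightarrow> real"
  assumes cont: "continuous_on (sphere 0 1) f" and nonneg: "\<And>z. cmod z = 1 \<Longrightarrow> 0 \<le> f z"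
    and zero: "circle_mean (\<lambda>z. of_real (f z)) = 0" and z: "cmod z = 1"
  shows "f z = 0"
proof -
  let ?e = "\<lambda>x::real. exp (2 * of_real pi * \<i> * of_real x)"
  have c: "continuous_on {0..1} (\<lambda>x. f (?e x))"
    by (rule continuous_on_compose2[OF cont]) (auto intro!: continuous_intros)
  have "(\<lambda>x. f (?e x)) integrable_on {0..1}" 
    using c by (rule integrable_continuous_real)
  hence i: "((\<lambda>x. f (?e x)) has_integral integral {0..1} (\<lambda>x. f (?e x))) {0..1}"
    by (rule integrable_integral)
  from has_integral_of_real[OF this, where 'b = complex]
  have "circle_mean (\<lambda>z. of_real (f z)) = of_real (integral {0..1} (\<lambda>x. f (?e x)))"
    unfolding circle_mean_conv_integral by (simp add: integral_unique)
  with zero i have i0: "((\<lambda>x. f (?e x)) has_integral 0) (cbox 0 1)" by simp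
  have *: "f (?e x) = 0" if "x \<in> cbox 0 1" for x
    by (rule has_integral_0_cbox_imp_0[OF _ _ i0]) (use c nonneg that in auto)
  have "z \<in> path_image (circlepath 0 1)" using z by simp
  then obtain x where "x \<in> {0..1}" "z = ?e x" by (auto simp: path_image_def circlepath)
  with * show ?thesis by simp
qed

section \<open>Infinite q-Pochhammer symbols\<close>

lemma qpoch_inf_convergent:
  assumes "cmod q < 1"
  shows "convergent_prod (\<lambda>i. 1 - a * q ^ i)"
proof -
  have "summable (\<lambda>i. norm ((1 - a * q ^ i) - 1))"
    using assms by (auto simp: norm_mult norm_power intro!: summable_mult summable_geometric)
  thus ?thesis
    by (intro abs_convergent_prod_imp_convergent_prod summable_imp_abs_convergent_prod)
qed

lemma qpoch_inf_rec:
  assumes "cmod q < 1"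
  shows "qpoch_inf a q = (1 - a) * qpoch_inf (a * q) q"
\<comment> \<open>Splitting off the head of the product requires a nonzero head; for a = 1 both
  sides vanish.\<close>
proof (cases "a = 1")
  case True
  have "prodinf (\<lambda>i. 1 - a * q ^ i) = 0"
    by (rule has_prod_zeroI[OF convergent_prod_has_prod[OF qpoch_inf_convergent[OF assms]], of _ 0])
      (simp add: True)
  thus ?thesis using True by (simp add: qpoch_inf_def)
next
  case False
  with prodinf_split_head[OF qpoch_inf_convergent[OF assms, of a]] show ?thesis
    by (simp add: qpoch_inf_def mult.assoc)
qed

lemma qpoch_inf_nonzero:
  assumes "cmod q < 1" "cmod a < 1"
  shows "qpoch_inf a q \<noteq> 0"
  unfolding qpoch_inf_def
proof (rule prodinf_nonzero[OF qpoch_inf_convergent[OF assms(1)]])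
  fix i
  have "cmod (a * q ^ i) \<le> cmod a * 1"
    unfolding norm_mult norm_power using assms by (intro mult_left_mono power_le_one) auto
  hence "cmod (a * q ^ i) < 1" using assms(2) by linarith
  thus "1 - a * q ^ i \<noteq> 0" by (metis eq_iff_diff_eq_0 less_irrefl norm_one)
qed

lemma qpoch_inf_cnj:
  assumes "cmod q < 1"
  shows "cnj (qpoch_inf a q) = qpoch_inf (cnj a) (cnj q)"
proof -
  let ?f = "\<lambda>a q n. \<Prod>i\<le>n. 1 - a * q ^ i"
  have lim: "?f a q \<longlonglongrightarrow> qpoch_inf a q" if "cmod q < 1" for a q
    unfolding qpoch_inf_def by (rule convergent_prod_LIMSEQ[OF qpoch_inf_convergent[OF that]])
  have "(\<lambda>n. cnj (?f a q n)) \<longlonglongrightarrow> cnj (qpoch_inf a q)"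
    by (intro tendsto_cnj lim assms)
  moreover have "(\<lambda>n. cnj (?f a q n)) = ?f (cnj a) (cnj q)" by (simp add: fun_eq_iff)
  ultimately show ?thesis using LIMSEQ_unique lim[of "cnj q" "cnj a"] assms by auto
qed

text \<open>On the closed unit disc around x, |a q^n| is at most (|x| + 1) |q|^n. The M-test
  therefore makes the finite products converge uniformly there, and the limit inherits
  holomorphy.\<close>

lemma qpoch_inf_holomorphic:
  assumes "cmod q < 1"
  shows "(\<lambda>a. qpoch_inf a q) holomorphic_on UNIV"
proof (rule holomorphic_uniform_sequence)
  show "(\<lambda>a. \<Prod>i<n. 1 - a * q ^ i) holomorphic_on UNIV" for n
    by (intro holomorphic_intros)
  fix x :: complex
  have "uniformly_convergent_on (cball x 1) (\<lambda>n a. \<Prod>i<n. 1 - a * q ^ i)"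
  proof (rule uniformly_convergent_on_prod')
    show "uniformly_convergent_on (cball x 1) (\<lambda>N a. \<Sum>n<N. cmod (1 - a * q ^ n - 1))"
    proof (rule Weierstrass_m_test'_ev)
      show "\<forall>\<^sub>F n in sequentially. \<forall>a\<in>cball x 1.
          norm (cmod (1 - a * q ^ n - 1)) \<le> (cmod x + 1) * cmod q ^ n"
      proof (intro always_eventually allI ballI)
        fix n and a assume "a \<in> cball x 1"
        hence "cmod a \<le> cmod x + 1" 
          using norm_triangle_ineq2[of a x] by (simp add: dist_norm norm_minus_commute)
        thus "norm (cmod (1 - a * q ^ n - 1)) \<le> (cmod x + 1) * cmod q ^ n"
          by (simp add: norm_mult norm_power mult_right_mono)
      qed
      show "summable (\<lambda>n. (cmod x + 1) * cmod q ^ n)"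
        using assms by (intro summable_mult summable_geometric) auto
    qed
  qed (auto intro!: continuous_intros)
  then obtain l where l: "uniform_limit (cball x 1) (\<lambda>n a. \<Prod>i<n. 1 - a * q ^ i) l sequentially"
    by (auto simp: uniformly_convergent_on_def)
  have eq: "l a = qpoch_inf a q" if "a \<in> cball x 1" for a
  proof -
    have "(\<lambda>n. \<Prod>i<n. 1 - a * q ^ i) \<longlonglongrightarrow> l a" by (rule tendsto_uniform_limitI[OF l that])
    moreover have "(\<lambda>n. \<Prod>i<n. 1 - a * q ^ i) \<longlonglongrightarrow> qpoch_inf a q"
      using convergent_prod_LIMSEQ[OF qpoch_inf_convergent[OF assms, of a]]
      by (simp add: LIMSEQ_lessThan_iff_atMost qpoch_inf_def)
    ultimately show ?thesis by (rule LIMSEQ_unique)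
  qed
  have "uniform_limit (cball x 1) (\<lambda>n a. \<Prod>i<n. 1 - a * q ^ i) (\<lambda>a. qpoch_inf a q) sequentially"
    by (rule iffD1[OF uniform_limit_cong' l]) (auto simp: eq)
  thus "\<exists>d>0. cball x d \<subseteq> UNIV \<and> uniform_limit (cball x d) (\<lambda>n a. \<Prod>i<n. 1 - a * q ^ i) (\<lambda>a. qpoch_inf a q) sequentially"
    by (intro exI[of _ 1]) auto
qed auto

lemma holomorphic_on_qpoch_inf [holomorphic_intros]:
  assumes "cmod q < 1" "f holomorphic_on A"
  shows "(\<lambda>z. qpoch_inf (f z) q) holomorphic_on A"
  using holomorphic_on_compose_gen[OF assms(2) qpoch_inf_holomorphic[OF assms(1)]] by (simp add: o_def)

section \<open>The Askey--Wilson difference equation\<close>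

lemma qpoch_0 [simp]: "qpoch a q 0 = 1"
  by (simp add: qpoch_def)

lemma qpoch_Suc: "qpoch a q (Suc k) = qpoch a q k * (1 - a * q ^ k)"
  by (simp add: qpoch_def)

lemma qpoch_Suc_left: "qpoch a q (Suc k) = (1 - a) * qpoch (a * q) q k"
  by (simp add: qpoch_def prod.lessThan_Suc_shift mult.assoc del: prod.lessThan_Suc)

lemma qpoch_of_real: "qpoch (of_real a) (of_real q) k = of_real (qpoch a q k)"
  by (simp add: qpoch_def)

lemma qpoch_eq_0_iff:
  fixes a q :: "'a :: idom"
  shows "qpoch a q k = 0 \<longleftrightarrow> (\<exists>i<k. a * q ^ i = 1)"
  by (auto simp: qpoch_def)

lemma qpoch_nonzero:
  fixes a q :: real
  assumes "0 < q" "q < 1" "\<bar>a\<bar> < 1"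
  shows "qpoch a q k \<noteq> 0"
proof -
  have "a * q ^ i \<noteq> 1" for i
  proof -
    have "\<bar>a\<bar> * q ^ i \<le> \<bar>a\<bar> * 1" using assms by (intro mult_left_mono power_le_one) auto
    moreover have "\<bar>a * q ^ i\<bar> = \<bar>a\<bar> * q ^ i" using assms by (simp add: abs_mult)
    ultimately show ?thesis using assms by linarith
  qed
  thus ?thesis by (simp add: qpoch_eq_0_iff)
qed

text \<open>The z-dependent factors (az, a/z; q)_k of the k-th term of \<open>phi43\<close>. The
  q-difference operator is bidiagonal on these functions.\<close>

definition aw_basis :: "'a::field \<Rightarrow> 'a \<Rightarrow> nat \<Rightarrow> 'a \<Rightarrow> 'a" where
  "aw_basis a q k z = qpoch (a * z) q k * qpoch (a / z) q k"

lemma aw_basis_inverse: "aw_basis a q k (1 / z) = aw_basis a q k z"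
  by (simp add: aw_basis_def mult.commute)

lemma aw_basis_Suc:
  "aw_basis a q (Suc k) z = aw_basis a q k z * ((1 - a * q ^ k * z) * (1 - a * q ^ k / z))"
  by (simp add: aw_basis_def qpoch_Suc mult_ac)

text \<open>Both values on the left contain (aqz; q)_k and (a/z; q)_k; the remaining quadratic
  factors have a difference that factorizes. The multiplier 1 - az completes (aqz; q)_k to (az;
  q)_{k+1}, so that \<open>aw_basis a q k z\<close> reappears.\<close>

lemma aw_basis_dilate_diff:
  fixes a q z :: "'a::field"
  assumes "q \<noteq> 0" "z \<noteq> 0"
  shows "(1 - a * z) * (aw_basis a q (Suc k) (q * z) - aw_basis a q (Suc k) z) =
    (a * (1 - q ^ Suc k) * (z - 1 / (q * z))) * (1 - a * q ^ k * z) * aw_basis a q k z"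
proof -
  define A where "A = qpoch (a * z * q) q k"
  define B where "B = qpoch (a / z) q k"
  have 1: "qpoch (a * (q * z)) q (Suc k) = A * (1 - a * q ^ Suc k * z)"
    by (simp add: A_def qpoch_Suc mult_ac)
  have 2: "qpoch (a / (q * z)) q (Suc k) = (1 - a / (q * z)) * B"
    using assms by (simp add: B_def qpoch_Suc_left)
  have 3: "qpoch (a * z) q (Suc k) = (1 - a * z) * A" by (simp add: A_def qpoch_Suc_left)
  have 4: "qpoch (a / z) q (Suc k) = B * (1 - a * q ^ k / z)" by (simp add: B_def qpoch_Suc)
  have 5: "(1 - a * z) * A = qpoch (a * z) q k * (1 - a * q ^ k * z)"
    using 3 by (simp add: qpoch_Suc mult_ac)
  have "aw_basis a q (Suc k) (q * z) - aw_basis a q (Suc k) z =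
    A * B * ((1 - a * q ^ Suc k * z) * (1 - a / (q * z)) - (1 - a * z) * (1 - a * q ^ k / z))"
    unfolding aw_basis_def 1 2 3 4 by (simp add: algebra_simps)
  also have "(1 - a * q ^ Suc k * z) * (1 - a / (q * z)) - (1 - a * z) * (1 - a * q ^ k / z) =
    a * (1 - q ^ Suc k) * (z - 1 / (q * z))"
    using assms by (simp add: field_simps)
  finally have "(1 - a * z) * (aw_basis a q (Suc k) (q * z) - aw_basis a q (Suc k) z) =
    ((1 - a * z) * A) * B * (a * (1 - q ^ Suc k) * (z - 1 / (q * z)))"
    by (simp only: mult_ac)
  thus ?thesis unfolding 5 B_def aw_basis_def by (simp only: mult_ac)
qed

text \<open>The bracket on the left changes sign under inversion, hence is divisible by z - 1/z. The
  symmetric quotient is a combination of 1 and (1 - ez)(1 - e/z), and setting z = e gives the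
  constant term. It is applied with e = a q^k.\<close>

lemma aw_symmetrization:
  fixes b c d e z :: "'a::field"
  assumes "z \<noteq> 0"
  shows "e * ((z - 1 / z) * ((1 - b * z) * (1 - c * z) * (1 - d * z) * (1 - e * z) / z\<^sup>2 
            - z\<^sup>2 * ((1 - b / z) * (1 - c / z) * (1 - d / z) * (1 - e / z)))) =
    (z - 1 / z)\<^sup>2 * ((1 - b * c * d * e) * ((1 - e * z) * (1 - e / z))
       - (1 - b * e) * (1 - c * e) * (1 - d * e))"
  using assms by (simp add: divide_simps) algebra


text \<open>
  One of the two terms of the Askey--Wilson operator, multiplied by \<open>(1 - z\<^sup>2)(1 - z\<^sup>-\<^sup>2)\<close>; for symmetric
  \<open>f\<close> the other one is its value at \<open>1/z\<close>.
\<close>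

definition aw_half_op :: "'a::field \<Rightarrow> 'a \<Rightarrow> 'a \<Rightarrow> 'a \<Rightarrow> 'a \<Rightarrow> ('a \<Rightarrow> 'a) \<Rightarrow> 'a \<Rightarrow> 'a" where
  "aw_half_op a b c d q f z = (1 - 1 / z\<^sup>2) * ((1 - a * z) * (1 - b * z) * (1 - c * z) * (1 - d * z)) /
     (1 - q * z\<^sup>2) * (f (q * z) - f z)"

text \<open>The factor z - 1/(qz) from \<open>aw_basis_dilate_diff\<close> is -(1 - q z^2)/(qz), so
  the denominator of the operator cancels.\<close>

lemma aw_half_op_basis:
  fixes a b c d q z :: "'a::field" and k :: nat
  assumes "q \<noteq> 0" "z \<noteq> 0" "q * z\<^sup>2 \<noteq> 1"
  defines "e \<equiv> a * q ^ k"
  shows "aw_half_op a b c d q (aw_basis a q (Suc k)) z =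
    - ((1 - q ^ Suc k) / q ^ Suc k * e * aw_basis a q k z) *
      ((z - 1 / z) * ((1 - b * z) * (1 - c * z) * (1 - d * z) * (1 - e * z) / z\<^sup>2))"
proof -
  have *: "- u / (v * q) * (P * (q * X) * Y) = - (X * Y) * (u * (P / v))" for u v P X Y :: 'a
    using assms(1) by (cases "v = 0") (simp_all add: field_simps)
  have "aw_half_op a b c d q (aw_basis a q (Suc k)) z =
     (1 - 1 / z\<^sup>2) * ((1 - b * z) * (1 - c * z) * (1 - d * z)) / (1 - q * z\<^sup>2) *
     ((1 - a * z) * (aw_basis a q (Suc k) (q * z) - aw_basis a q (Suc k) z))"
    by (simp add: aw_half_op_def)
  also have "\<dots> = ((1 - 1 / z\<^sup>2) * (z - 1 / (q * z)) / (1 - q * z\<^sup>2)) *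
     (((1 - b * z) * (1 - c * z) * (1 - d * z) * (1 - e * z)) * (a * (1 - q ^ Suc k)) * aw_basis a q k z)"
    unfolding aw_basis_dilate_diff[OF assms(1,2)] by (simp add: e_def)
  also have "(1 - 1 / z\<^sup>2) * (z - 1 / (q * z)) / (1 - q * z\<^sup>2) = - (z - 1 / z) / (z\<^sup>2 * q)"
    using assms(1-3) by (simp add: divide_simps) (simp add: algebra_simps power2_eq_square)
  also have "a * (1 - q ^ Suc k) = q * ((1 - q ^ Suc k) / q ^ Suc k * e)"
    using assms by (simp add: e_def)
  finally show ?thesis by (rule trans[OF _ *])
qed

lemma aw_half_op_basis_0: "aw_half_op a b c d q (aw_basis a q 0) z = 0"
  by (simp add: aw_half_op_def aw_basis_def)

text \<open>The Askey--Wilson eigenvalue q^(-k) (1 - q^k)(1 - A q^(k-1)), where A is the product of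
  the four parameters. Dividing by q avoids a truncated exponent at k = 0.\<close>

definition aw_eigenvalue :: "'a::field \<Rightarrow> 'a \<Rightarrow> nat \<Rightarrow> 'a" where
  "aw_eigenvalue A q k = (1 / q ^ k - 1) * (1 - A * q ^ k / q)"

text \<open>Adding the terms at z and 1/z produces the expression in
  \<open>aw_symmetrization\<close>, whose two summands raise k to k + 1 or leave it unchanged. The
  hypothesis on q and z^2 is the one on q z^2 read at 1/z.\<close>

lemma aw_op_basis:
  fixes a b c d q z :: "'a::field"
  assumes "q \<noteq> 0" "z \<noteq> 0" "q * z\<^sup>2 \<noteq> 1" "q \<noteq> z\<^sup>2"
  shows "aw_half_op a b c d q (aw_basis a q (Suc k)) z + aw_half_op a b c d q (aw_basis a q (Suc k)) (1 / z) =
    (1 - z\<^sup>2) * (1 - 1 / z\<^sup>2) *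
      (aw_eigenvalue (a * b * c * d) q (Suc k) * aw_basis a q (Suc k) z -
       (1 / q ^ Suc k - 1) * (1 - a * b * q ^ k) * (1 - a * c * q ^ k) * (1 - a * d * q ^ k) * aw_basis a q k z)"
proof -
  define e where "e = a * q ^ k"
  have z': "1 / z \<noteq> 0" "q * (1 / z)\<^sup>2 \<noteq> 1" using assms by (auto simp: power_divide)
  note * = aw_half_op_basis[OF assms(1) assms(2,3), of a b c d k, folded e_def]
     aw_half_op_basis[OF assms(1) z', of a b c d k, folded e_def]
  have "aw_half_op a b c d q (aw_basis a q (Suc k)) z + aw_half_op a b c d q (aw_basis a q (Suc k)) (1 / z) =
    - ((1 - q ^ Suc k) / q ^ Suc k * aw_basis a q k z) *
    (e * ((z - 1 / z) * ((1 - b * z) * (1 - c * z) * (1 - d * z) * (1 - e * z) / z\<^sup>2 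
            - z\<^sup>2 * ((1 - b / z) * (1 - c / z) * (1 - d / z) * (1 - e / z)))))"
  proof -
    have "- (X * e * Y) * ((z - w) * A) + - (X * e * Y) * ((w - z) * B) =
        - (X * Y) * (e * ((z - w) * (A - B)))" for X Y A B w
      by (simp add: algebra_simps)
    moreover have "x / (1 / z)\<^sup>2 = z\<^sup>2 * x" "x * (1 / z) = x / z" "1 / (1 / z) = z" for x
      by (simp_all add: power_divide)
    ultimately show ?thesis unfolding * aw_basis_inverse by presburger
  qed
  also have "\<dots> = ((z - 1 / z)\<^sup>2 * (- ((1 - q ^ Suc k) / q ^ Suc k))) * 
     ((1 - b * c * d * e) * (aw_basis a q k z * ((1 - e * z) * (1 - e / z)))
       - (1 - b * e) * (1 - c * e) * (1 - d * e) * aw_basis a q k z)"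
  proof -
    have "- (X * Y) * (S * (p * M - N)) = (S * - X) * (p * (Y * M) - N * Y)" for X Y S p M N :: 'a
      by (simp add: algebra_simps)
    thus ?thesis unfolding aw_symmetrization[OF assms(2)] by blast
  qed
  also have "aw_basis a q k z * ((1 - e * z) * (1 - e / z)) = aw_basis a q (Suc k) z"
    by (simp add: aw_basis_Suc e_def)
  also have "(z - 1 / z)\<^sup>2 * (- ((1 - q ^ Suc k) / q ^ Suc k)) = 
     (1 - z\<^sup>2) * (1 - 1 / z\<^sup>2) * (1 / q ^ Suc k - 1)"
    using assms by (simp add: divide_simps) algebra
  also have "b * c * d * e = a * b * c * d * q ^ Suc k / q"
    using assms(1) by (simp add: e_def)
  also have "1 - b * e = 1 - a * b * q ^ k" by (simp add: e_def)
  also have "1 - c * e = 1 - a * c * q ^ k" by (simp add: e_def)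
  also have "1 - d * e = 1 - a * d * q ^ k" by (simp add: e_def)
  finally have *: "aw_half_op a b c d q (aw_basis a q (Suc k)) z + aw_half_op a b c d q (aw_basis a q (Suc k)) (1 / z) =
    (1 - z\<^sup>2) * (1 - 1 / z\<^sup>2) * (1 / q ^ Suc k - 1) * ((1 - a * b * c * d * q ^ Suc k / q) * aw_basis a q (Suc k) z -
    (1 - a * b * q ^ k) * (1 - a * c * q ^ k) * (1 - a * d * q ^ k) * aw_basis a q k z)" .
  have "s * w * (p * M - x * y * u * N) = s * (w * p * M - w * x * y * u * N)" for s w p M x y u N :: 'a
    by (simp add: algebra_simps)
  with * show ?thesis unfolding aw_eigenvalue_def by (rule trans)
qed

text \<open>The hypothesis on C compares the coefficients of \<open>aw_basis a q k\<close> in the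
  eigenvalue equation of the bidiagonal operator.\<close>

lemma aw_op_sum:
  fixes a b c d q z :: "'a::field" and C :: "nat \<Rightarrow> 'a"
  assumes "q \<noteq> 0" "z \<noteq> 0" "q * z\<^sup>2 \<noteq> 1" "q \<noteq> z\<^sup>2"
  assumes C: "\<And>k. k < n \<Longrightarrow> C (Suc k) * ((1 / q ^ Suc k - 1) * (1 - a * b * q ^ k) * (1 - a * c * q ^ k) * (1 - a * d * q ^ k)) =
     C k * (aw_eigenvalue (a * b * c * d) q k - aw_eigenvalue (a * b * c * d) q n)"
  defines "F \<equiv> \<lambda>z. \<Sum>k\<le>n. C k * aw_basis a q k z"
  shows "aw_half_op a b c d q F z + aw_half_op a b c d q F (1 / z) =
    aw_eigenvalue (a * b * c * d) q n * ((1 - z\<^sup>2) * (1 - 1 / z\<^sup>2)) * F z"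
proof -
  let ?l = "aw_eigenvalue (a * b * c * d) q" and ?h = "aw_half_op a b c d q" and ?\<phi> = "aw_basis a q"
  let ?m = "\<lambda>k. (1 / q ^ Suc k - 1) * (1 - a * b * q ^ k) * (1 - a * c * q ^ k) * (1 - a * d * q ^ k)"
  let ?s = "(1 - z\<^sup>2) * (1 - 1 / z\<^sup>2)"
  have lin: "?h F z = (\<Sum>k\<le>n. C k * ?h (?\<phi> k) z)" for z
    unfolding aw_half_op_def F_def sum_subtractf[symmetric] right_diff_distrib[symmetric] sum_distrib_left
    by (intro sum.cong refl) (simp only: mult.left_commute)
  have "?h F z + ?h F (1 / z) = (\<Sum>k\<le>n. C k * (?h (?\<phi> k) z + ?h (?\<phi> k) (1 / z)))"
    by (simp add: lin sum.distrib distrib_left)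
  \<comment> \<open>The term k = 0 drops out because the basis function of index 0 is
    constant.\<close>
  also have "\<dots> = (\<Sum>k<n. C (Suc k) * (?h (?\<phi> (Suc k)) z + ?h (?\<phi> (Suc k)) (1 / z)))"
    by (simp add: lessThan_Suc_atMost[symmetric] sum.lessThan_Suc_shift aw_half_op_basis_0 del: sum.lessThan_Suc)
  also have "\<dots> = (\<Sum>k<n. ?s * (C (Suc k) * ?l (Suc k) * ?\<phi> (Suc k) z - (C (Suc k) * ?m k) * ?\<phi> k z))"
    unfolding aw_op_basis[OF assms(1-4)] by (simp add: algebra_simps)
  also have "\<dots> = (\<Sum>k<n. ?s * (C (Suc k) * ?l (Suc k) * ?\<phi> (Suc k) z - C k * (?l k - ?l n) * ?\<phi> k z))"
    by (intro sum.cong refl) (simp only: C lessThan_iff)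
  also have "\<dots> = ?s * ((\<Sum>k<n. C (Suc k) * ?l (Suc k) * ?\<phi> (Suc k) z - C k * ?l k * ?\<phi> k z) + ?l n * (\<Sum>k<n. C k * ?\<phi> k z))"
    by (simp add: sum_distrib_left sum.distrib[symmetric] algebra_simps)
  \<comment> \<open>The lower end of the telescoping sum vanishes because the eigenvalue of index 0
    is 0.\<close>
  also have "(\<Sum>k<n. C (Suc k) * ?l (Suc k) * ?\<phi> (Suc k) z - C k * ?l k * ?\<phi> k z) = ?l n * (C n * ?\<phi> n z)"
    by (subst sum_lessThan_telescope) (simp add: aw_eigenvalue_def)
  also have "?s * (?l n * (C n * ?\<phi> n z) + ?l n * (\<Sum>k<n. C k * ?\<phi> k z)) = ?l n * ?s * F z"
    by (simp add: F_def lessThan_Suc_atMost[symmetric] distrib_left mult_ac)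
  finally show ?thesis .
qed

lemma aw_eigenvalue_diff:
  fixes A q :: "'a::field"
  assumes "q \<noteq> 0" "k \<le> n"
  shows "aw_eigenvalue A q k - aw_eigenvalue A q n = (1 - q ^ (n - k)) * (1 - A * q ^ (n + k) / q) * (- 1 / q ^ n)"
proof -
  obtain m where "n = k + m" using assms(2) le_Suc_ex by blast
  thus ?thesis using assms(1)
    by (simp add: aw_eigenvalue_def power_add field_simps)
qed

section \<open>The coefficients of \<open>AW_R\<close> with respect to
  \<open>aw_basis\<close>\<close>

text \<open>The part of the k-th term of \<open>phi43\<close> that is free of z. Being real, it
  serves both for the formal variable \<open>fls_X\<close> and for complex z.\<close>

definition aw_coeff :: "real \<Rightarrow> real \<Rightarrow> real \<Rightarrow> real \<Rightarrow> real \<Rightarrow> nat \<Rightarrow> nat \<Rightarrow> real" where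
  "aw_coeff q a b c d n k = (qpoch (q powi (- int n)) q k * qpoch (a * b * c * d * q powi (int n - 1)) q k) /
     (qpoch q q k * qpoch (a * b) q k * qpoch (a * c) q k * qpoch (a * d) q k) * q ^ k"

lemma abs_mult_less_1: "\<bar>x\<bar> < 1 \<Longrightarrow> \<bar>y\<bar> < 1 \<Longrightarrow> \<bar>x * y\<bar> < 1" for x y :: real
  using mult_strict_mono'[of "\<bar>x\<bar>" 1 "\<bar>y\<bar>" 1] by (simp add: abs_mult)

context
  fixes q a b c d :: real
  assumes q: "0 < q" "q < 1" and t: "\<bar>a\<bar> < 1" "\<bar>b\<bar> < 1" "\<bar>c\<bar> < 1" "\<bar>d\<bar> < 1"
begin

lemma aw_coeff_0 [simp]: "aw_coeff q a b c d n 0 = 1"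
  by (simp add: aw_coeff_def)

text \<open>This is the recurrence required by \<open>aw_op_sum\<close>. The two new numerator
  factors of the series are, up to powers of q, the factors of the eigenvalue difference in
  \<open>aw_eigenvalue_diff\<close>; the new denominator factors cancel.\<close>

lemma aw_coeff_Suc:
  assumes "k < n"
  shows "aw_coeff q a b c d n (Suc k) * ((1 / q ^ Suc k - 1) * (1 - a * b * q ^ k) * (1 - a * c * q ^ k) * (1 - a * d * q ^ k)) =
     aw_coeff q a b c d n k * (aw_eigenvalue (a * b * c * d) q k - aw_eigenvalue (a * b * c * d) q n)"
proof -
  let ?N = "\<lambda>k. qpoch (q powi (- int n)) q k * qpoch (a * b * c * d * q powi (int n - 1)) q k"
  let ?D = "\<lambda>k. qpoch q q k * qpoch (a * b) q k * qpoch (a * c) q k * qpoch (a * d) q k"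
  have D: "?D (Suc k) = ?D k * ((1 - q ^ Suc k) * (1 - a * b * q ^ k) * (1 - a * c * q ^ k) * (1 - a * d * q ^ k))"
    by (simp add: qpoch_Suc mult_ac)
  have nz: "?D j \<noteq> 0" for j
    using qpoch_nonzero[OF q] q t by (simp add: abs_mult_less_1)
  have nz': "(1 - q ^ Suc k) * (1 - a * b * q ^ k) * (1 - a * c * q ^ k) * (1 - a * d * q ^ k) \<noteq> 0" (is "?d \<noteq> 0")
    using nz[of "Suc k"] unfolding D by simp
  obtain m where m: "n = k + m" using assms less_imp_add_positive by blast
  have N: "?N (Suc k) * (q ^ Suc k * (1 / q ^ Suc k)) = ?N k * (aw_eigenvalue (a * b * c * d) q k - aw_eigenvalue (a * b * c * d) q n) * q ^ k"
  proof -
    have "q powi (- int n) = 1 / q ^ n" by (simp add: power_int_minus inverse_eq_divide)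
    hence "1 - q powi (- int n) * q ^ k = (1 - q ^ (n - k)) * (- 1 / q ^ n) * q ^ k"
      using q by (simp add: m power_add field_simps)
    moreover have "1 - a * b * c * d * q powi (int n - 1) * q ^ k = 1 - a * b * c * d * q ^ (n + k) / q"
      using q by (simp add: power_int_diff power_add field_simps)
    moreover have "q ^ Suc k * (1 / q ^ Suc k) = 1" using q by simp
    ultimately show ?thesis
      using q assms by (simp only: qpoch_Suc aw_eigenvalue_diff less_imp_le) (simp only: mult_ac mult_1_right)
  qed
  have "aw_coeff q a b c d n (Suc k) * ((1 / q ^ Suc k - 1) * (1 - a * b * q ^ k) * (1 - a * c * q ^ k) * (1 - a * d * q ^ k)) =
     ?N (Suc k) / (?D k * ?d) * q ^ Suc k * (1 / q ^ Suc k * ?d)"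
  proof -
    have "1 / q ^ Suc k - 1 = 1 / q ^ Suc k * (1 - q ^ Suc k)" using q by (simp add: field_simps)
    thus ?thesis unfolding aw_coeff_def D by (simp only: mult.assoc)
  qed
  also have "\<dots> = ?N (Suc k) * (q ^ Suc k * (1 / q ^ Suc k)) / ?D k"
  proof -
    have "N / (D * d) * Q * (R * d) = N * (Q * R) / D" if "d \<noteq> 0" for N D d Q R :: real
      using that by simp
    thus ?thesis using nz' by blast
  qed
  also have "\<dots> = aw_coeff q a b c d n k * (aw_eigenvalue (a * b * c * d) q k - aw_eigenvalue (a * b * c * d) q n)"
    unfolding N aw_coeff_def by simp
  finally show ?thesis .
qed

text \<open>In \<open>aw_eigenvalue_diff\<close> no factor vanishes: n - m is positive, and n + m -
  1 is a genuine exponent, so |abcd| < 1 keeps abcd q^(n+m-1) away from 1.\<close>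

lemma aw_eigenvalue_distinct:
  assumes "m < n"
  shows "aw_eigenvalue (a * b * c * d) q m \<noteq> aw_eigenvalue (a * b * c * d) q n"
proof -
  have "\<bar>a * b * c * d\<bar> < 1" using t by (simp add: abs_mult_less_1)
  moreover have "q ^ (n + m) / q = q ^ (n + m - 1)" using q assms by (simp add: power_diff)
  hence "\<bar>q ^ (n + m) / q\<bar> \<le> 1" using q by (simp add: power_le_one)
  ultimately have "\<bar>a * b * c * d * (q ^ (n + m) / q)\<bar> < 1"
    unfolding abs_mult[of _ "q ^ (n + m) / q"] by (meson abs_ge_zero le_less_trans mult_right_le_one_le)
  hence "1 - a * b * c * d * q ^ (n + m) / q \<noteq> 0" by auto
  moreover have "q ^ (n - m) < 1" using q assms by (simp add: power_Suc_less_one power_less_one_iff)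
  ultimately have "aw_eigenvalue (a * b * c * d) q m - aw_eigenvalue (a * b * c * d) q n \<noteq> 0"
    using q aw_eigenvalue_diff[of q m n "a * b * c * d"] assms by simp
  thus ?thesis by simp
qed

text \<open>The factor (q^(-n); q)_k kills all terms beyond n, so the series is a finite sum in any
  topology on the field.\<close>

lemma AW_R_eq_sum:
  fixes z :: "'a::{real_field, t2_space}"
  shows "AW_R q a b c d n z = (\<Sum>k\<le>n. of_real (aw_coeff q a b c d n k) * aw_basis (of_real a) (of_real q) k z)"
proof -
  have 0: "qpoch (q powi (- int n)) q k = 0" if "n < k" for k
    using that q by (auto simp: qpoch_eq_0_iff power_int_minus intro!: exI[of _ n])
  have "AW_R q a b c d n z = (\<Sum>k. of_real (aw_coeff q a b c d n k) * aw_basis (of_real a) (of_real q) k z)"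
    unfolding AW_R_def phi43_def aw_coeff_def aw_basis_def qpoch_of_real
    by (intro arg_cong[where f = suminf] ext) (simp add: mult_ac)
  also have "\<dots> = (\<Sum>k\<le>n. of_real (aw_coeff q a b c d n k) * aw_basis (of_real a) (of_real q) k z)"
    by (intro suminf_finite) (auto simp: aw_coeff_def 0)
  finally show ?thesis .
qed

end

section \<open>Laurent polynomials\<close>

text \<open>An infinite radius of convergence discharges the side conditions for evaluating sums and
  products at any nonzero point.\<close>

lemma fls_conv_radius_PInf:
  assumes "fls_conv_radius F = \<infinity>" "fls_conv_radius G = \<infinity>"
  shows "fls_conv_radius (F + G) = \<infinity>" "fls_conv_radius (F - G) = \<infinity>" "fls_conv_radius (F * G) = \<infinity>"
  using fls_conv_radius_add[of F G] fls_conv_radius_diff[of F G] fls_conv_radius_mult[of F G] assms by auto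

lemma fls_conv_radius_sum_PInf:
  assumes "\<And>i. i \<in> I \<Longrightarrow> fls_conv_radius (F i) = \<infinity>"
  shows "fls_conv_radius (\<Sum>i\<in>I. F i) = \<infinity>"
  using assms by (induction I rule: infinite_finite_induct) (auto simp: fls_conv_radius_PInf)

lemma fls_conv_radius_of_real [simp]: "fls_conv_radius (of_real r) = \<infinity>"
  by (simp add: of_real_fls)

lemma eval_fls_of_real [simp]: "eval_fls (of_real r) z = of_real r"
  by (simp add: of_real_fls)

lemma eval_fls_X_inv [simp]: "eval_fls fls_X_inv z = inverse z"
  using eval_fls_X_intpow[of "-1" z] by (simp add: fls_X_inv_conv_shift_1 power_int_minus)

lemma eval_fls_sum:
  assumes "\<And>i. i \<in> I \<Longrightarrow> fls_conv_radius (F i) = \<infinity>" "z \<noteq> 0"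
  shows "eval_fls (\<Sum>i\<in>I. F i) z = (\<Sum>i\<in>I. eval_fls (F i) z)"
  using assms by (induction I rule: infinite_finite_induct)
    (auto simp: eval_fls_add fls_conv_radius_sum_PInf)

lemma scaleR_eq_of_real_mult: "r *\<^sub>R F = of_real r * F" for F :: "complex fls"
  by (rule scaleR_conv_of_real)

lemma subspace_laurent_space: "subspace (laurent_space n)"
  by (simp add: laurent_space_def)

lemma laurent_space_conv_radius:
  assumes "f \<in> laurent_space n"
  shows "fls_conv_radius f = \<infinity>"
  using assms unfolding laurent_space_def
  by (rule span_induct) (auto simp: subspace_def scaleR_eq_of_real_mult intro!: fls_conv_radius_PInf)

lemma laurent_space_mono: "m \<le> n \<Longrightarrow> laurent_space m \<subseteq> laurent_space n"
  unfolding laurent_space_def by (intro span_mono image_mono) auto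

lemma X_intpow_mult_laurent_space:
  assumes "f \<in> laurent_space n" "j \<in> {-1..1}"
  shows "fls_X_intpow j * f \<in> laurent_space (Suc n)"
  using assms(1) unfolding laurent_space_def
proof (rule span_induct)
  show "subspace {f. fls_X_intpow j * f \<in> span (fls_X_intpow ` {- int (Suc n)..int (Suc n)})}"
    by (auto simp: subspace_def distrib_left span_add span_scale span_zero)
  fix x :: "complex fls" assume "x \<in> fls_X_intpow ` {- int n..int n}"
  then obtain i where "i \<in> {- int n..int n}" "x = fls_X_intpow i" by auto
  thus "fls_X_intpow j * x \<in> span (fls_X_intpow ` {- int (Suc n)..int (Suc n)})"
    using assms(2) by (auto intro!: span_base image_eqI[of _ _ "j + i"] simp: fls_X_intpow_times_fls_X_intpow)
qed

text \<open>Both the step from \<open>aw_basis\<close> at k to k + 1 and the prefactor of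
  \<open>AW_U\<close> are real combinations of 1/z, 1 and z; each raises the degree bound by
  one.\<close>

lemma laurent_space_step:
  assumes "f \<in> laurent_space n"
  shows "(of_real a / fls_X + of_real b + of_real c * fls_X) * f \<in> laurent_space (Suc n)"
proof -
  have eq: "(A / x + B + C * x) * f = A * (inverse x * f) + B * (1 * f) + C * (x * f)" for A B C x :: "complex fls"
    by (simp add: algebra_simps divide_inverse)
  have "inverse fls_X * f \<in> laurent_space (Suc n)"
    using X_intpow_mult_laurent_space[OF assms, of "-1"] by (simp add: fls_inverse_X fls_X_inv_conv_shift_1)
  moreover have "1 * f \<in> laurent_space (Suc n)"
    using X_intpow_mult_laurent_space[OF assms, of 0] by simp
  moreover have "fls_X * f \<in> laurent_space (Suc n)"
    using X_intpow_mult_laurent_space[OF assms, of 1] by (simp add: fls_X_conv_shift_1)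
  ultimately show ?thesis
    unfolding eq unfolding scaleR_eq_of_real_mult[symmetric]
    by (intro subspace_add subspace_scale subspace_laurent_space)
qed

lemma one_in_laurent_space: "1 \<in> laurent_space n"
  unfolding laurent_space_def by (rule span_base) (auto intro!: image_eqI[of _ _ 0])

lemma aw_basis_laurent_space: "aw_basis (of_real a) (of_real q) k fls_X \<in> laurent_space k"
proof (induction k)
  case 0
  show ?case by (simp add: aw_basis_def one_in_laurent_space)
next
  case (Suc k)
  let ?e = "a * q ^ k"
  have "(1 - e * x) * (1 - e / x) = - e / x + (1 + e\<^sup>2) + - e * x" if "x \<noteq> 0" for e x :: "complex fls"
    using that by (simp add: field_simps power2_eq_square)
  note expand = this[OF fls_X_nonzero, of "of_real ?e"]
  have "aw_basis (of_real a) (of_real q) (Suc k) (fls_X :: complex fls) =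
    ((1 - of_real ?e * fls_X) * (1 - of_real ?e / fls_X)) * aw_basis (of_real a) (of_real q) k fls_X"
    by (simp only: aw_basis_Suc of_real_mult of_real_power mult.commute)
  also have "\<dots> = (of_real (- ?e) / fls_X + of_real (1 + ?e\<^sup>2) + of_real (- ?e) * fls_X) * aw_basis (of_real a) (of_real q) k fls_X"
    unfolding expand by (simp only: of_real_minus of_real_add of_real_1 of_real_power)
  finally have "aw_basis (of_real a) (of_real q) (Suc k) (fls_X :: complex fls) = \<dots>" .
  with laurent_space_step[OF Suc] show ?case by (simp only:)
qed

lemma eval_fls_aw_basis:
  assumes "z \<noteq> 0"
  shows "eval_fls (aw_basis (of_real a) (of_real q) k fls_X) z = aw_basis (of_real a) (of_real q) k z"
proof (induction k)
  case 0
  show ?case by (simp add: aw_basis_def)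
next
  case (Suc k)
  let ?e = "a * q ^ k"
  \<comment> \<open>Stated over an arbitrary real field, so that it unfolds both the formal side at
    \<open>fls_X\<close> and the numerical side at \<open>z\<close>.\<close>
  have "aw_basis (of_real a) (of_real q) (Suc k) x =
     (1 - of_real ?e * x) * (1 - of_real ?e * inverse x) * aw_basis (of_real a) (of_real q) k x" for x :: "'a::real_field"
    unfolding aw_basis_Suc by (simp add: divide_inverse)
  note step = this
  show ?case unfolding step using Suc assms laurent_space_conv_radius[OF aw_basis_laurent_space]
    by (simp add: eval_fls_mult eval_fls_diff fls_conv_radius_PInf fls_inverse_X del: of_real_mult)
qed

context
  fixes q t1 t2 t3 t4 :: real
  assumes q: "0 < q" "q < 1" and t: "\<bar>t1\<bar> < 1" "\<bar>t2\<bar> < 1" "\<bar>t3\<bar> < 1" "\<bar>t4\<bar> < 1"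
begin

lemma AW_R_laurent_space: "AW_R q t1 t2 t3 t4 n fls_X \<in> laurent_space n"
  unfolding AW_R_eq_sum[OF q t] scaleR_eq_of_real_mult[symmetric]
  by (intro subspace_sum subspace_scale subspace_laurent_space
    subsetD[OF laurent_space_mono aw_basis_laurent_space]) auto

lemma eval_fls_AW_R:
  assumes "z \<noteq> 0"
  shows "eval_fls (AW_R q t1 t2 t3 t4 n fls_X) z = AW_R q t1 t2 t3 t4 n z"
proof -
  note r = laurent_space_conv_radius[OF aw_basis_laurent_space]
  show ?thesis unfolding AW_R_eq_sum[OF q t] using assms r
    by (subst eval_fls_sum) (auto simp: fls_conv_radius_PInf eval_fls_mult eval_fls_aw_basis)
qed

end

context
  fixes q t1 t2 t3 t4 :: real
  assumes q: "0 < q" "q < 1" and t: "\<bar>t1\<bar> < 1" "\<bar>t2\<bar> < 1" "\<bar>t3\<bar> < 1" "\<bar>t4\<bar> < 1"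
begin

lemma abs_q_mult_less_1: "\<bar>q * t1\<bar> < 1" "\<bar>q * t2\<bar> < 1"
  using q t by (simp_all add: abs_mult_less_1)

lemma AW_U_laurent_space:
  assumes "0 < n"
  shows "AW_U q t1 t2 t3 t4 n fls_X \<in> laurent_space n"
proof -
  obtain m where m: "n = Suc m" using assms by (cases n) auto
  have "1 / x * (1 - a * x) * (1 - b * x) = 1 / x + - (a + b) + a * b * x" if "x \<noteq> 0" for a b x :: "complex fls"
    using that by (simp add: field_simps)
  note expand = this[OF fls_X_nonzero]
  have "AW_U q t1 t2 t3 t4 n (fls_X :: complex fls) =
     (of_real 1 / fls_X + of_real (- (t1 + t2)) + of_real (t1 * t2) * fls_X) * AW_R q (q * t1) (q * t2) t3 t4 m fls_X"
    unfolding AW_U_def m expand by (simp only: of_real_minus of_real_add of_real_1 of_real_mult diff_Suc_1)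
  thus ?thesis
    using laurent_space_step[OF AW_R_laurent_space[OF q abs_q_mult_less_1 t(3,4), of m], of 1 "- (t1 + t2)" "t1 * t2"]
    unfolding m by (simp only:)
qed

lemma eval_fls_AW_U:
  assumes "z \<noteq> 0"
  shows "eval_fls (AW_U q t1 t2 t3 t4 n fls_X) z = AW_U q t1 t2 t3 t4 n z"
proof -
  note r = laurent_space_conv_radius[OF AW_R_laurent_space[OF q abs_q_mult_less_1 t(3,4)]]
  show ?thesis
    unfolding AW_U_def using assms r
    by (simp add: eval_fls_mult eval_fls_diff fls_conv_radius_PInf divide_inverse fls_inverse_X
      eval_fls_AW_R[OF q abs_q_mult_less_1 t(3,4)])
qed

end

section \<open>Linear algebra: orthogonal families as bases\<close>

text \<open>Pairing a vanishing combination with x leaves only the coefficient of x times the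
  nonzero \<open>form x x\<close>. Linearity is assumed only for real combinations over B, which is
  what \<open>cher_form_sum\<close> provides.\<close>

lemma independent_orthogonal:
  fixes form :: "'v::real_vector \<Rightarrow> 'v \<Rightarrow> complex"
  assumes fin: "finite B" and orth: "pairwise (\<lambda>f g. form f g = 0) B" and nz: "\<And>f. f \<in> B \<Longrightarrow> form f f \<noteq> 0"
    and lin: "\<And>u g. g \<in> B \<Longrightarrow> form (\<Sum>v\<in>B. u v *\<^sub>R v) g = (\<Sum>v\<in>B. of_real (u v) * form v g)"
  shows "independent B"
proof (rule independent_if_scalars_zero[OF fin])
  fix u x assume s: "(\<Sum>x\<in>B. u x *\<^sub>R x) = 0" and x: "x \<in> B"
  \<comment> \<open>The vanishing of \<open>form 0 x\<close> comes from the linearity hypothesis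
    with all coefficients 0.\<close>
  have "form 0 x = (\<Sum>v\<in>B. of_real 0 * form v x)" using lin[OF x, of "\<lambda>_. 0"] by simp
  hence "0 = form (\<Sum>v\<in>B. u v *\<^sub>R v) x" by (simp add: s)
  also have "\<dots> = (\<Sum>v\<in>B. of_real (u v) * form v x)" by (rule lin[OF x])
  also have "\<dots> = (\<Sum>v\<in>{x}. of_real (u v) * form v x)"
    using orth x by (intro sum.mono_neutral_right fin) (auto simp: pairwise_def)
  finally show "u x = 0" using nz[OF x] by simp
qed

text \<open>Otherwise a vector of span C outside span B could be added to B, giving an independent
  set with more elements than the spanning set C.\<close>

lemma span_eq_if_card_ge:
  fixes B C :: "'v::real_vector set"
  assumes "independent B" "B \<subseteq> span C" "finite C" "card C \<le> card B"
  shows "span B = span C"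
proof
  show "span B \<subseteq> span C" using assms(2) by (simp add: span_minimal)
  have finB: "finite B" using independent_span_bound[OF assms(3,1,2)] by simp
  show "span C \<subseteq> span B"
  proof (rule ccontr)
    assume "\<not> span C \<subseteq> span B"
    then obtain x where x: "x \<in> span C" "x \<notin> span B" by auto
    hence "independent (insert x B)" "x \<notin> B" using assms(1) by (auto simp: independent_insert span_base)
    with independent_span_bound[OF assms(3), of "insert x B"] x(1) assms finB show False by simp
  qed
qed

section \<open>Orthogonality for the Askey--Wilson weight\<close>

definition aw_den :: "real \<Rightarrow> real \<Rightarrow> real \<Rightarrow> real \<Rightarrow> real \<Rightarrow> complex \<Rightarrow> complex" where
  "aw_den q t1 t2 t3 t4 z = qpoch_inf (of_real t1 * z) (of_real q) * qpoch_inf (of_real t2 * z) (of_real q) *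
     qpoch_inf (of_real t3 * z) (of_real q) * qpoch_inf (of_real t4 * z) (of_real q)"

text \<open>
  The Askey--Wilson weight has double zeros at \<open>z = \<plusminus>1\<close>. Removing them leaves the factor \<open>aw_w0\<close>,
  which lets both weights be written without a division that is undefined on the circle.
\<close>

definition aw_w0 :: "real \<Rightarrow> real \<Rightarrow> real \<Rightarrow> real \<Rightarrow> real \<Rightarrow> complex \<Rightarrow> complex" where
  "aw_w0 q t1 t2 t3 t4 z = qpoch_inf (of_real q) (of_real q) * qpoch_inf (of_real q * z\<^sup>2) (of_real q) *
     qpoch_inf (of_real q / z\<^sup>2) (of_real q) / (aw_den q t1 t2 t3 t4 z * aw_den q t1 t2 t3 t4 (1 / z))"

definition aw_weight :: "real \<Rightarrow> real \<Rightarrow> real \<Rightarrow> real \<Rightarrow> real \<Rightarrow> complex \<Rightarrow> complex" where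
  "aw_weight q t1 t2 t3 t4 z = aw_w0 q t1 t2 t3 t4 z * ((1 - z\<^sup>2) * (1 - 1 / z\<^sup>2))"

text \<open>
  The factors that have to be cancelled to make the weight holomorphic on \<open>q \<le> |z| \<le> 1\<close> are removed.
  Dilation by \<open>q\<close> acts on this kernel as the inversion \<open>z \<mapsto> 1/z\<close>, and this gives self-adjointness.
\<close>

definition aw_shift_kernel :: "real \<Rightarrow> real \<Rightarrow> real \<Rightarrow> real \<Rightarrow> real \<Rightarrow> complex \<Rightarrow> complex" where
  "aw_shift_kernel q t1 t2 t3 t4 z = qpoch_inf (of_real q) (of_real q) * qpoch_inf (z\<^sup>2) (of_real q) *
     qpoch_inf (of_real (q\<^sup>2) / z\<^sup>2) (of_real q) / (aw_den q t1 t2 t3 t4 z * aw_den q t1 t2 t3 t4 (of_real q / z))"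

lemma aw_w0_inverse: "aw_w0 q t1 t2 t3 t4 (1 / z) = aw_w0 q t1 t2 t3 t4 z"
  by (simp add: aw_w0_def power_divide mult_ac)

text \<open>The kernel is invariant under z -> q/z, which exchanges z^2 with q^2/z^2 and the two
  denominators.\<close>

lemma aw_shift_kernel_dilate:
  assumes "q \<noteq> 0"
  shows "aw_shift_kernel q t1 t2 t3 t4 (of_real q * z) = aw_shift_kernel q t1 t2 t3 t4 (1 / z)"
  using assms by (simp add: aw_shift_kernel_def power_divide power_mult_distrib mult_ac)

text \<open>The test functions of the operator: holomorphy on the punctured plane permits dilations
  and contour shifts. At z = 0 the symmetry is vacuous, since 1/0 = 0.\<close>

definition symmetric_holomorphic :: "(complex \<Rightarrow> complex) \<Rightarrow> bool" where
  "symmetric_holomorphic f \<longleftrightarrow> f holomorphic_on - {0} \<and> (\<forall>z. f (1 / z) = f z)"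

lemma symmetric_holomorphicD:
  assumes "symmetric_holomorphic f"
  shows "f holomorphic_on - {0}" "f (1 / z) = f z" "continuous_on (sphere 0 1) f"
  using assms holomorphic_on_imp_continuous_on continuous_on_subset[of "- {0}" f "sphere 0 1"]
  by (auto simp: symmetric_holomorphic_def)

lemma symmetric_holomorphic_mult:
  "symmetric_holomorphic f \<Longrightarrow> symmetric_holomorphic g \<Longrightarrow> symmetric_holomorphic (\<lambda>z. f z * g z)"
  by (auto simp: symmetric_holomorphic_def intro!: holomorphic_intros)

locale aw_parameters =
  fixes q t1 t2 t3 t4 :: real
  assumes q: "0 < q" "q < 1" and t: "\<bar>t1\<bar> < 1" "\<bar>t2\<bar> < 1" "\<bar>t3\<bar> < 1" "\<bar>t4\<bar> < 1"
begin

abbreviation "den \<equiv> aw_den q t1 t2 t3 t4"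
abbreviation "w0 \<equiv> aw_w0 q t1 t2 t3 t4"
abbreviation "weight \<equiv> aw_weight q t1 t2 t3 t4"
abbreviation "shift_kernel \<equiv> aw_shift_kernel q t1 t2 t3 t4"
abbreviation "R \<equiv> AW_R q t1 t2 t3 t4"
abbreviation "half_op \<equiv> aw_half_op (of_real t1 :: complex) (of_real t2) (of_real t3) (of_real t4) (of_real q)"

lemma cmod_q: "cmod (of_real q) < 1"
  using q by simp

lemma den_holomorphic [holomorphic_intros]: "f holomorphic_on A \<Longrightarrow> (\<lambda>z. den (f z)) holomorphic_on A"
  unfolding aw_den_def by (intro holomorphic_intros cmod_q)

text \<open>The bound T stays explicit because the contour shift needs a zero-free disc strictly
  larger than the unit disc.\<close>

lemma den_nonzero:
  assumes "\<bar>t1\<bar> \<le> T" "\<bar>t2\<bar> \<le> T" "\<bar>t3\<bar> \<le> T" "\<bar>t4\<bar> \<le> T" "T * cmod z < 1"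
  shows "den z \<noteq> 0"
proof -
  have "cmod (of_real s * z) < 1" if "\<bar>s\<bar> \<le> T" for s
    using mult_right_mono[OF that, of "cmod z"] assms(5) by (simp add: norm_mult)
  thus ?thesis using assms cmod_q by (simp add: aw_den_def qpoch_inf_nonzero)
qed

lemma t_bound:
  obtains T where "0 < T" "T < 1" "\<bar>t1\<bar> \<le> T" "\<bar>t2\<bar> \<le> T" "\<bar>t3\<bar> \<le> T" "\<bar>t4\<bar> \<le> T"
proof -
  \<comment> \<open>The entry 1/2 keeps the maximum positive even if all four parameters
    vanish.\<close>
  define A where "A = {1 / 2, \<bar>t1\<bar>, \<bar>t2\<bar>, \<bar>t3\<bar>, \<bar>t4\<bar>}"
  have A: "finite A" "A \<noteq> {}" "\<And>x. x \<in> A \<Longrightarrow> x < 1" using t by (auto simp: A_def)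
  have le: "x \<le> Max A" if "x \<in> A" for x by (rule Max_ge[OF A(1) that])
  have "0 < Max A" using le[of "1 / 2"] by (simp add: A_def)
  moreover have "Max A < 1" by (subst Max_less_iff[OF A(1,2)]) (use A(3) in blast)
  ultimately show ?thesis by (rule that) (rule le, simp add: A_def)+
qed

lemma den_nonzero_le_1: "cmod z \<le> 1 \<Longrightarrow> den z \<noteq> 0"
proof (rule t_bound)
  fix T assume T: "0 < T" "T < 1" "\<bar>t1\<bar> \<le> T" "\<bar>t2\<bar> \<le> T" "\<bar>t3\<bar> \<le> T" "\<bar>t4\<bar> \<le> T" and z: "cmod z \<le> 1"
  have "T * cmod z \<le> T * 1" using T z by (intro mult_left_mono) auto
  hence "T * cmod z < 1" using T(2) by linarith
  thus "den z \<noteq> 0" using T by (intro den_nonzero[of T])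
qed

lemma den_rec:
  "den z = ((1 - of_real t1 * z) * (1 - of_real t2 * z) * (1 - of_real t3 * z) * (1 - of_real t4 * z)) * den (of_real q * z)"
proof -
  have "qpoch_inf (of_real s * z) (of_real q) = (1 - of_real s * z) * qpoch_inf (of_real s * (of_real q * z)) (of_real q)" for s :: real
    using qpoch_inf_rec[OF cmod_q, of "of_real s * z"] by (simp add: mult_ac)
  note * = this[of t1] this[of t2] this[of t3] this[of t4]
  show ?thesis unfolding aw_den_def * by (simp only: mult_ac)
qed

lemma linear_factor_nonzero:
  assumes "cmod z = 1" "\<bar>s\<bar> < 1"
  shows "1 - of_real s * z \<noteq> 0" "1 - of_real s / z \<noteq> 0"
proof -
  have "cmod (of_real s * z) < 1" "cmod (of_real s / z) < 1" using assms by (simp_all add: norm_mult norm_divide)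
  thus "1 - of_real s * z \<noteq> 0" "1 - of_real s / z \<noteq> 0" by (metis eq_iff_diff_eq_0 less_irrefl norm_one)+
qed

lemma w0_continuous: "continuous_on (sphere 0 1) w0"
proof -
  have "w0 holomorphic_on sphere 0 1"
    unfolding aw_w0_def
    by (intro holomorphic_intros cmod_q) (auto simp: den_nonzero_le_1 norm_divide)
  thus ?thesis by (rule holomorphic_on_imp_continuous_on)
qed

text \<open>The denominators of the kernel have no zero for qT < |z| < 1/T. Since T < 1, this open
  annulus contains q <= |z| <= 1, so the contour shift meets no pole.\<close>

lemma kernel_mean:
  assumes "p holomorphic_on - {0}"
  shows "circle_mean (\<lambda>z. p (of_real q * z) * shift_kernel (of_real q * z)) = circle_mean (\<lambda>z. p z * shift_kernel z)"
proof -
  obtain T where T: "0 < T" "T < 1" "\<bar>t1\<bar> \<le> T" "\<bar>t2\<bar> \<le> T" "\<bar>t3\<bar> \<le> T" "\<bar>t4\<bar> \<le> T" by (rule t_bound)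
  define S where "S = {z. q * T < cmod z} \<inter> {z. T * cmod z < 1}"
  have z: "den z \<noteq> 0 \<and> den (of_real q / z) \<noteq> 0 \<and> z \<noteq> 0" if "z \<in> S" for z
  proof -
    have "0 < cmod z" using that T q unfolding S_def by (smt (verit) Int_iff mem_Collect_eq mult_pos_pos)
    hence "T * cmod (of_real q / z) < 1" using that q by (simp add: S_def norm_divide field_simps)
    thus ?thesis using that T den_nonzero \<open>0 < cmod z\<close> by (auto simp: S_def)
  qed
  show ?thesis
  proof (rule circle_mean_dilate[where f = "\<lambda>z. p z * shift_kernel z" and S = S, OF q])
    show "open S" unfolding S_def by (intro open_Int open_Collect_less continuous_intros)
    show "z \<in> S" if "q \<le> cmod z" "cmod z \<le> 1" for z
    proof -
      have "q * T < q * 1" using q T by (intro mult_strict_left_mono) auto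
      moreover have "T * cmod z \<le> T * 1" using that T by (intro mult_left_mono) auto
      ultimately have "q * T < cmod z" "T * cmod z < 1" using that T(2) by linarith+
      thus ?thesis by (simp add: S_def)
    qed
    have "S \<subseteq> - {0}" using z by auto
    thus "(\<lambda>z. p z * shift_kernel z) holomorphic_on S"
      unfolding aw_shift_kernel_def using z
      by (intro holomorphic_intros holomorphic_on_subset[OF assms] cmod_q) auto
  qed
qed

lemma circle_q_nonzero:
  assumes "cmod z = 1"
  shows "1 - of_real q * z\<^sup>2 \<noteq> 0" "of_real q * z\<^sup>2 \<noteq> 1" "of_real q \<noteq> z\<^sup>2"
proof -
  have "cmod (of_real q * z\<^sup>2) < 1" "cmod (z\<^sup>2) = 1" using assms q by (simp_all add: norm_mult norm_power)
  thus "of_real q * z\<^sup>2 \<noteq> 1" "of_real q \<noteq> z\<^sup>2" using cmod_q by (metis norm_one less_irrefl, metis less_irrefl)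
  thus "1 - of_real q * z\<^sup>2 \<noteq> 0" by simp
qed

text \<open>One recurrence step in (1/z^2; q), (q z^2; q) and \<open>den z\<close> produces exactly
  the coefficient of the operator. Thus the contour shift for the kernel becomes a statement about
  \<open>half_op\<close>.\<close>

lemma kernel_half_op:
  assumes z: "cmod z = 1"
  shows "shift_kernel (1 / z) * (f (of_real q * z) - f z) = w0 z * half_op f z"
proof -
  let ?P = "\<lambda>a. qpoch_inf a (of_real q)"
  let ?\<pi> = "(1 - of_real t1 * z) * (1 - of_real t2 * z) * (1 - of_real t3 * z) * (1 - of_real t4 * z)"
  have 1: "?P (1 / z\<^sup>2) = (1 - 1 / z\<^sup>2) * ?P (of_real q / z\<^sup>2)"
    using qpoch_inf_rec[OF cmod_q, of "1 / z\<^sup>2"] by simp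
  have 2: "?P (of_real q * z\<^sup>2) = (1 - of_real q * z\<^sup>2) * ?P (of_real (q\<^sup>2) * z\<^sup>2)"
    using qpoch_inf_rec[OF cmod_q, of "of_real q * z\<^sup>2"] by (simp add: power2_eq_square mult_ac)
  have nz: "?\<pi> \<noteq> 0" "1 - of_real q * z\<^sup>2 \<noteq> 0"
    using linear_factor_nonzero[OF z] t circle_q_nonzero[OF z] by auto
  have "shift_kernel (1 / z) = ?P (of_real q) * ?P (1 / z\<^sup>2) * ?P (of_real (q\<^sup>2) * z\<^sup>2) / (den (1 / z) * den (of_real q * z))"
    by (simp add: aw_shift_kernel_def power_divide)
  also have "\<dots> = w0 z * ((1 - 1 / z\<^sup>2) * ?\<pi> / (1 - of_real q * z\<^sup>2))"
  proof -
    have "A * (x * B) * C / (D * E) = A * (y * C) * B / (u * E * D) * (x * u / y)" if "u \<noteq> 0" "y \<noteq> 0"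
      for A B C D E x y u :: complex using that by (simp add: field_simps)
    from this[OF nz] show ?thesis unfolding aw_w0_def 1 2 den_rec[of z] by blast
  qed
  finally show ?thesis by (simp add: aw_half_op_def)
qed

lemma half_op_continuous:
  assumes "symmetric_holomorphic f"
  shows "continuous_on (sphere 0 1) (half_op f)"
proof -
  note f = symmetric_holomorphicD[OF assms]
  have "continuous_on (sphere 0 1) (\<lambda>z. f (of_real q * z))"
    by (rule continuous_on_compose2[OF holomorphic_on_imp_continuous_on[OF f(1)]])
      (use q in \<open>auto intro!: continuous_intros\<close>)
  thus ?thesis unfolding aw_half_op_def using f(3) circle_q_nonzero
    by (intro continuous_intros) auto
qed

text \<open>The difference h of the integrands is p(qz) K(qz), where K is the kernel and p is
  antisymmetric in f and g, a q-analogue of the Wronskian. The contour shift replaces qz by z,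
  inversion replaces z by 1/z, and p(1/z) K(1/z) = -h(z); so the mean of h equals its own
  negative.\<close>

lemma half_op_self_adjoint:
  assumes f: "symmetric_holomorphic f" and g: "symmetric_holomorphic g"
  shows "circle_mean (\<lambda>z. w0 z * half_op f z * g z) = circle_mean (\<lambda>z. w0 z * half_op g z * f z)"
proof -
  note f' = symmetric_holomorphicD[OF f] and g' = symmetric_holomorphicD[OF g]
  define p where "p z = f z * g (z / of_real q) - f (z / of_real q) * g z" for z
  define h where "h z = w0 z * half_op f z * g z - w0 z * half_op g z * f z" for z
  have inv: "f (1 / z / of_real q) = f (of_real q * z)" "g (1 / z / of_real q) = g (of_real q * z)" for z
    using f'(2)[of "of_real q * z"] g'(2)[of "of_real q * z"] by (simp_all add: mult.commute)
  have p: "p holomorphic_on - {0}"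
  proof -
    have "(\<lambda>z. F (z / of_real q)) holomorphic_on - {0}" if "F holomorphic_on - {0}" for F
    proof -
      have "(\<lambda>z. z / of_real q) holomorphic_on - {0}" using q by (intro holomorphic_intros) auto
      moreover have "(\<lambda>z. z / of_real q) ` (- {0}) \<subseteq> - {0 :: complex}" using q by auto
      ultimately show ?thesis using holomorphic_on_compose_gen[OF _ that] by (fastforce simp: o_def)
    qed
    thus ?thesis unfolding p_def using f'(1) g'(1) by (intro holomorphic_intros)
  qed
  have h1: "p (of_real q * z) * shift_kernel (of_real q * z) = h z" if "cmod z = 1" for z
  proof -
    have "p (of_real q * z) * shift_kernel (of_real q * z) = 
      (shift_kernel (1 / z) * (f (of_real q * z) - f z)) * g z - (shift_kernel (1 / z) * (g (of_real q * z) - g z)) * f z"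
    proof -
      have "shift_kernel (of_real q * z) = shift_kernel (1 / z)" using q by (simp add: aw_shift_kernel_dilate)
      moreover have "p (of_real q * z) = f (of_real q * z) * g z - f z * g (of_real q * z)"
        using q by (simp add: p_def)
      ultimately show ?thesis by (simp only:) (simp add: algebra_simps)
    qed
    thus ?thesis unfolding kernel_half_op[OF that] h_def .
  qed
  have h2: "p (1 / z) * shift_kernel (1 / z) = - h z" if "cmod z = 1" for z
  proof -
    have "p (1 / z) = - p (of_real q * z)" using q by (simp add: p_def f'(2) g'(2) inv mult.commute[of z])
    thus ?thesis using h1[OF that] q by (simp add: aw_shift_kernel_dilate)
  qed
  have ch: "continuous_on (sphere 0 1) h" unfolding h_def
    by (intro continuous_intros w0_continuous half_op_continuous f g f' g')
  \<comment> \<open>On the circle this product is -h(1/z), so its continuity follows from that of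
    h.\<close>
  have pk: "continuous_on (sphere 0 1) (\<lambda>z. p z * shift_kernel z)"
  proof -
    have "p z * shift_kernel z = - h (1 / z)" if "z \<in> sphere 0 1" for z
      using h2[of "1 / z"] that by (cases "z = 0") (simp_all add: norm_divide)
    moreover have "continuous_on (sphere 0 1) (\<lambda>z. - h (1 / z))"
      by (intro continuous_intros continuous_on_compose2[OF ch]) (auto simp: norm_divide)
    ultimately show ?thesis by (subst continuous_on_cong[OF refl])
  qed
  have "circle_mean h = circle_mean (\<lambda>z. p (of_real q * z) * shift_kernel (of_real q * z))"
    by (rule circle_mean_cong) (simp add: h1)
  also have "\<dots> = circle_mean (\<lambda>z. p z * shift_kernel z)" by (rule kernel_mean[OF p])
  also have "\<dots> = circle_mean (\<lambda>z. p (1 / z) * shift_kernel (1 / z))" by (rule circle_mean_reflect[OF pk, symmetric])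
  also have "\<dots> = circle_mean (\<lambda>z. (- 1) * h z)" by (rule circle_mean_cong) (simp add: h2)
  also have "\<dots> = - circle_mean h" using circle_mean_cmult[of "- 1" h] by simp
  finally have "circle_mean h = 0" by simp
  thus ?thesis unfolding h_def
    by (subst (asm) circle_mean_diff)
      (intro continuous_intros w0_continuous half_op_continuous f g f' g' | simp)+
qed

text \<open>The mean is invariant under inversion. With c = 0 this disposes of antisymmetric
  integrands.\<close>

lemma symmetrize_mean:
  assumes "continuous_on (sphere 0 1) F" "\<And>z. cmod z = 1 \<Longrightarrow> F z + F (1 / z) = c * G z"
  shows "2 * circle_mean F = c * circle_mean G"
proof -
  have "continuous_on (sphere 0 1) (\<lambda>z. F (1 / z))"
    by (rule continuous_on_compose2[OF assms(1)]) (auto intro!: continuous_intros simp: norm_divide)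
  hence "circle_mean (\<lambda>z. F z + F (1 / z)) = 2 * circle_mean F"
    by (simp add: circle_mean_add assms(1) circle_mean_reflect)
  moreover have "circle_mean (\<lambda>z. F z + F (1 / z)) = c * circle_mean G"
    using assms(2) by (simp add: circle_mean_cmult[symmetric] cong: circle_mean_cong)
  ultimately show ?thesis by simp
qed

definition "eigenvalue n = aw_eigenvalue (of_real (t1 * t2 * t3 * t4) :: complex) (of_real q) n"

lemma R_symmetric_holomorphic: "symmetric_holomorphic (R n)"
  unfolding symmetric_holomorphic_def AW_R_eq_sum[OF q t] aw_basis_inverse
  by (auto simp: aw_basis_def qpoch_def intro!: holomorphic_intros)

lemma R_eigenfunction:
  assumes z: "cmod z = 1"
  shows "half_op (R n) z + half_op (R n) (1 / z) = eigenvalue n * ((1 - z\<^sup>2) * (1 - 1 / z\<^sup>2)) * R n z"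
proof -
  let ?C = "\<lambda>k. of_real (aw_coeff q t1 t2 t3 t4 n k) :: complex"
  have C: "?C (Suc k) * ((1 / of_real q ^ Suc k - 1) * (1 - of_real t1 * of_real t2 * of_real q ^ k) *
       (1 - of_real t1 * of_real t3 * of_real q ^ k) * (1 - of_real t1 * of_real t4 * of_real q ^ k)) =
     ?C k * (aw_eigenvalue (of_real t1 * of_real t2 * of_real t3 * of_real t4) (of_real q) k -
       aw_eigenvalue (of_real t1 * of_real t2 * of_real t3 * of_real t4) (of_real q) n)" if "k < n" for k
    using arg_cong[OF aw_coeff_Suc[OF q t that], of "of_real :: real \<Rightarrow> complex"]
    by (simp add: aw_eigenvalue_def)
  have z': "z \<noteq> 0" using z by auto
  have "R n = (\<lambda>z. \<Sum>k\<le>n. ?C k * aw_basis (of_real t1) (of_real q) k z)"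
    by (rule ext) (rule AW_R_eq_sum[OF q t])
  thus ?thesis
    using aw_op_sum[where C = ?C and a = "of_real t1" and b = "of_real t2" and c = "of_real t3" and d = "of_real t4", 
        OF _ _ circle_q_nonzero(2,3)[OF z] C] q z'
    by (simp add: eigenvalue_def)
qed

text \<open>Averaging over z and 1/z completes \<open>half_op\<close> to the full operator; the
  eigenvalue equation then supplies the factor that turns \<open>w0\<close> into
  \<open>weight\<close>.\<close>

lemma R_mean_eigen:
  assumes g: "symmetric_holomorphic g"
  shows "2 * circle_mean (\<lambda>z. w0 z * half_op (R n) z * g z) = eigenvalue n * circle_mean (\<lambda>z. weight z * (R n z * g z))"
proof (rule symmetrize_mean)
  note g' = symmetric_holomorphicD[OF g]
  show "continuous_on (sphere 0 1) (\<lambda>z. w0 z * half_op (R n) z * g z)"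
    by (intro continuous_intros w0_continuous half_op_continuous g' R_symmetric_holomorphic)
  fix z :: complex assume z: "cmod z = 1"
  have "w0 z * half_op (R n) z * g z + w0 (1 / z) * half_op (R n) (1 / z) * g (1 / z) =
    w0 z * (half_op (R n) z + half_op (R n) (1 / z)) * g z"
    by (simp add: aw_w0_inverse g'(2) algebra_simps)
  also have "\<dots> = eigenvalue n * (weight z * (R n z * g z))"
    unfolding R_eigenfunction[OF z] aw_weight_def by (simp only: mult_ac)
  finally show "w0 z * half_op (R n) z * g z + w0 (1 / z) * half_op (R n) (1 / z) * g (1 / z) =
     eigenvalue n * (weight z * (R n z * g z))" .
qed

lemma eigenvalue_distinct:
  assumes "m \<noteq> n"
  shows "eigenvalue m \<noteq> eigenvalue n"
proof -
  have "eigenvalue k = of_real (aw_eigenvalue (t1 * t2 * t3 * t4) q k)" for k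
    by (simp add: eigenvalue_def aw_eigenvalue_def)
  thus ?thesis using assms aw_eigenvalue_distinct[OF q t] by (metis linorder_neqE_nat of_real_eq_iff)
qed

lemma R_orthogonal:
  assumes "m \<noteq> n"
  shows "circle_mean (\<lambda>z. weight z * (R m z * R n z)) = 0"
proof -
  have "eigenvalue m * circle_mean (\<lambda>z. weight z * (R m z * R n z)) = eigenvalue n * circle_mean (\<lambda>z. weight z * (R n z * R m z))"
    unfolding R_mean_eigen[OF R_symmetric_holomorphic, symmetric]
      half_op_self_adjoint[OF R_symmetric_holomorphic[of m] R_symmetric_holomorphic[of n]] ..
  thus ?thesis using eigenvalue_distinct[OF assms] by (simp add: mult.commute)
qed

section \<open>Norms with respect to the Askey--Wilson weight\<close>

text \<open>At z = t1 the factor (t1/z; q)_k vanishes for k > 0, leaving the term 1. For n = 0 the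
  polynomial is constant and 1/2 serves. The bound on s excludes the zeros of 1 - z^2.\<close>

lemma R_takes_value_1:
  assumes "t1 \<noteq> 0 \<or> n = 0"
  shows "\<exists>s. s \<noteq> 0 \<and> \<bar>s\<bar> < 1 \<and> R n (of_real s :: complex) = 1"
proof (cases "n = 0")
  case True
  thus ?thesis by (intro exI[of _ "1/2"]) (simp add: AW_R_eq_sum[OF q t] aw_coeff_0[OF q t] aw_basis_def)
next
  case False
  have "aw_basis (of_real t1) (of_real q) (Suc k) (of_real t1 :: complex) = 0" for k
    using assms False by (simp add: aw_basis_def qpoch_Suc_left)
  hence "R n (of_real t1 :: complex) = 1"
    unfolding AW_R_eq_sum[OF q t] sum.atMost_shift by (simp add: aw_coeff_0[OF q t]) (simp add: aw_basis_def)
  thus ?thesis using assms False t by (intro exI[of _ t1]) auto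
qed

lemma cnj_unit_circle:
  assumes "cmod z = 1"
  shows "cnj z = 1 / z"
proof -
  have "z * cnj z = 1" using complex_norm_square[of z] assms by simp
  moreover have "z \<noteq> 0" using assms by auto
  ultimately show ?thesis by (simp add: eq_divide_eq mult.commute)
qed

lemma R_cnj: "cnj (R n z) = R n (cnj z)"
  unfolding AW_R_eq_sum[OF q t] by (simp add: aw_basis_def qpoch_def)

lemma den_cnj: "cnj (den z) = den (cnj z)"
  unfolding aw_den_def using cmod_q by (simp add: qpoch_inf_cnj)

text \<open>On the circle 1/z is the conjugate of z, so the factors pair off into squared moduli;
  only the constant (q; q)_inf remains.\<close>

lemma weight_conv_norm:
  assumes z: "cmod z = 1"
  shows "weight z = qpoch_inf (of_real q) (of_real q) * of_real ((cmod (qpoch_inf (z\<^sup>2) (of_real q)) / cmod (den z))\<^sup>2)"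
proof -
  let ?P = "\<lambda>a. qpoch_inf a (of_real q)"
  have c: "cnj z = 1 / z" by (rule cnj_unit_circle[OF z])
  have "weight z = ?P (of_real q) * (?P (z\<^sup>2) * ?P (1 / z\<^sup>2)) / (den z * den (1 / z))"
    using qpoch_inf_rec[OF cmod_q, of "z\<^sup>2"] qpoch_inf_rec[OF cmod_q, of "1 / z\<^sup>2"]
    by (simp add: aw_weight_def aw_w0_def mult_ac)
  also have "?P (1 / z\<^sup>2) = cnj (?P (z\<^sup>2))"
    using c cmod_q by (simp add: qpoch_inf_cnj power_divide)
  also have "den (1 / z) = cnj (den z)" by (simp add: den_cnj c)
  finally show ?thesis
    by (simp only: complex_norm_square[symmetric] power_divide of_real_divide of_real_mult times_divide_eq_right)
qed

text \<open>On the circle R_n is real, so the integrand is a nonzero constant times a nonnegative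
  function. A zero mean would force (1 - z^2) R_n to vanish on the circle, hence on the whole
  punctured plane.\<close>

lemma R_norm_nonzero:
  assumes nondeg: "t1 \<noteq> 0 \<or> n = 0"
  shows "circle_mean (\<lambda>z. weight z * (R n z * R n z)) \<noteq> 0"
proof
  assume zero: "circle_mean (\<lambda>z. weight z * (R n z * R n z)) = 0"
  let ?P = "\<lambda>a. qpoch_inf a (of_real q)"
  define F where "F z = (cmod (?P (z\<^sup>2)) / cmod (den z) * cmod (R n z))\<^sup>2" for z
  note R = symmetric_holomorphicD[OF R_symmetric_holomorphic[of n]]
  have "circle_mean (\<lambda>z. weight z * (R n z * R n z)) = circle_mean (\<lambda>z. ?P (of_real q) * of_real (F z))"
  proof (rule circle_mean_cong)
    fix z :: complex assume z: "cmod z = 1"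
    have c: "cnj z = 1 / z" by (rule cnj_unit_circle[OF z])
    have "R n z * R n z = of_real ((cmod (R n z))\<^sup>2)"
      by (simp only: complex_norm_square R_cnj c R(2))
    thus "weight z * (R n z * R n z) = ?P (of_real q) * of_real (F z)"
      unfolding weight_conv_norm[OF z] F_def power_mult_distrib by simp
  qed
  hence "circle_mean (\<lambda>z. of_real (F z)) = 0"
    using zero qpoch_inf_nonzero[OF cmod_q cmod_q] by (simp add: circle_mean_cmult)
  moreover have "continuous_on (sphere 0 1) F"
  proof -
    have "(\<lambda>z. ?P (z\<^sup>2)) holomorphic_on sphere 0 1" "den holomorphic_on sphere 0 1"
      by (intro holomorphic_intros cmod_q)+
    note this[THEN holomorphic_on_imp_continuous_on]
    thus ?thesis unfolding F_def using R(3)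
      by (intro continuous_intros) (auto simp: den_nonzero_le_1)
  qed
  ultimately have F: "F z = 0" if "cmod z = 1" for z
    using circle_mean_of_real_eq_0D[of F z] that by (simp add: F_def)
  \<comment> \<open>Only the first factor of (z^2; q)_inf can vanish on the circle; keeping it
    spares a separate treatment of z = 1 and z = -1.\<close>
  have circle: "(1 - z\<^sup>2) * R n z = 0" if z: "z \<in> sphere 0 1" for z :: complex
  proof -
    have "cmod (of_real q * z\<^sup>2) < 1" using q z by (simp add: norm_mult norm_power)
    hence "?P (of_real q * z\<^sup>2) \<noteq> 0" using qpoch_inf_nonzero[OF cmod_q] by blast
    thus ?thesis using F[of z] z qpoch_inf_rec[OF cmod_q, of "z\<^sup>2"] den_nonzero_le_1[of z]
      by (auto simp: F_def mult.commute)
  qed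
  obtain s where s: "s \<noteq> 0" "\<bar>s\<bar> < 1" "R n (of_real s :: complex) = 1" using R_takes_value_1[OF nondeg] by blast
  have "(1 - (of_real s)\<^sup>2) * R n (of_real s :: complex) = 0"
  proof (rule analytic_continuation[where S = "- {0}" and U = "sphere 0 1" and \<xi> = 1 and f = "\<lambda>z. (1 - z\<^sup>2) * R n z"])
    show "(\<lambda>z. (1 - z\<^sup>2) * R n z) holomorphic_on - {0}" by (intro holomorphic_intros R)
    show "connected (- {0 :: complex})" by (rule connected_punctured_universe) simp
    \<comment> \<open>A connected set with more than one point has no isolated point.\<close>
    have "(- 1 :: complex) \<in> sphere 0 1" "(1 :: complex) \<in> sphere 0 1" by simp_all
    moreover have "(1 :: complex) \<noteq> - 1" by simp
    ultimately have "sphere 0 1 \<noteq> {x :: complex}" for x by (metis singletonD)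
    thus "(1 :: complex) islimpt sphere 0 1"
      by (intro connected_imp_perfect connected_sphere) auto
  qed (use s circle in auto)
  hence "(of_real s :: complex)\<^sup>2 = 1" using s by simp
  hence "s\<^sup>2 = 1" by (metis of_real_eq_1_iff of_real_power)
  thus False using s(2) by (auto simp: power2_eq_1_iff)
qed

end

section \<open>The Cherednik form\<close>

context aw_parameters
begin

abbreviation "cher \<equiv> cher_form q t1 t2 t3 t4"
abbreviation "S n \<equiv> AW_R q (q * t1) (q * t2) t3 t4 n"
abbreviation "U \<equiv> AW_U q t1 t2 t3 t4"

lemma aw_parameters_shifted: "aw_parameters q (q * t1) (q * t2) t3 t4"
  using q t by unfold_locales (simp_all add: abs_mult_less_1)

text \<open>One factor is split off from each of (z^2; q), (t1/z; q) and (t2/z; q). What remains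
  beside \<open>w0\<close> is the part that is not invariant under inversion.\<close>

lemma w_cher_eq:
  assumes z: "cmod z = 1"
  shows "w_cher q t1 t2 t3 t4 z = w0 z * ((1 - z\<^sup>2) * (1 - of_real t1 / z) * (1 - of_real t2 / z))"
proof -
  let ?P = "\<lambda>a. qpoch_inf a (of_real q)"
  have 1: "?P (z\<^sup>2) = (1 - z\<^sup>2) * ?P (of_real q * z\<^sup>2)"
    using qpoch_inf_rec[OF cmod_q, of "z\<^sup>2"] by (simp add: mult_ac)
  have 2: "?P (of_real s / z) = (1 - of_real s / z) * ?P (of_real (q * s) / z)" for s :: real
    using qpoch_inf_rec[OF cmod_q, of "of_real s / z"] by (simp add: mult_ac)
  have nz: "1 - of_real t1 / z \<noteq> 0" "1 - of_real t2 / z \<noteq> 0"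
    using linear_factor_nonzero[OF z] t by auto
  have den: "den (1 / z) = (1 - of_real t1 / z) * (1 - of_real t2 / z) *
      (?P (of_real t3 / z) * ?P (of_real t4 / z) * ?P (of_real (q * t1) / z) * ?P (of_real (q * t2) / z))"
    by (simp add: aw_den_def 2[of t1] 2[of t2] mult_ac)
  have *: "a * (x * b) * c / (D * E) = a * b * c / (D * (y * y' * E)) * (x * y * y')" if "y \<noteq> 0" "y' \<noteq> 0"
    for a b c x y y' D E :: complex using that by (simp add: field_simps)
  show ?thesis unfolding w_cher_def Let_def aw_w0_def den 1 aw_den_def[of _ _ _ _ _ z] by (rule *[OF nz])
qed

lemma w_cher_continuous: "continuous_on (sphere 0 1) (w_cher q t1 t2 t3 t4)"
proof -
  have "continuous_on (sphere 0 1) (\<lambda>z. w0 z * ((1 - z\<^sup>2) * (1 - of_real t1 / z) * (1 - of_real t2 / z)))"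
    by (intro continuous_intros w0_continuous) auto
  thus ?thesis by (rule continuous_on_eq) (simp add: w_cher_eq)
qed

text \<open>Passing from t1, t2 to q t1, q t2 removes the first factors of the denominators at z and
  at 1/z; they reappear from \<open>w_cher_eq\<close> and the prefactor of
  \<open>AW_U\<close>.\<close>

lemma w0_shifted:
  assumes z: "cmod z = 1"
  shows "aw_w0 q (q * t1) (q * t2) t3 t4 z =
    w0 z * ((1 - of_real t1 * z) * (1 - of_real t1 / z) * ((1 - of_real t2 * z) * (1 - of_real t2 / z)))"
proof -
  have den: "den x = (1 - of_real t1 * x) * (1 - of_real t2 * x) * aw_den q (q * t1) (q * t2) t3 t4 x" for x
    using qpoch_inf_rec[OF cmod_q, of "of_real t1 * x"] qpoch_inf_rec[OF cmod_q, of "of_real t2 * x"]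
    by (simp add: aw_den_def mult_ac)
  have nz: "1 - of_real t1 / z \<noteq> 0" "1 - of_real t2 / z \<noteq> 0" "1 - of_real t1 * z \<noteq> 0" "1 - of_real t2 * z \<noteq> 0"
    using linear_factor_nonzero[OF z] t by auto
  have *: "a / (d * e) = a / (x * y * d * (x' * y' * e)) * (x * x' * (y * y'))"
    if "x' \<noteq> 0" "y' \<noteq> 0" "x \<noteq> 0" "y \<noteq> 0" for a d e x y x' y' :: complex
    using that by (simp add: field_simps)
  show ?thesis unfolding aw_w0_def den[of z] den[of "1 / z", unfolded times_divide_eq_right mult_1_right]
    by (rule *[OF nz])
qed

lemma cher_form_conv_mean:
  "cher f g = circle_mean (\<lambda>z. eval_fls f z * eval_fls g z * w_cher q t1 t2 t3 t4 z)"
  by (simp add: cher_form_def circle_mean_def)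

lemma cher_form_commute: "cher f g = cher g f"
  by (simp add: cher_form_conv_mean mult.commute)

text \<open>The source of the factor 1 - t1 t2 in \<open>cher_R_R\<close> and
  \<open>cher_U_U\<close>.\<close>

lemma weight_symmetrization:
  fixes z :: complex
  assumes "z \<noteq> 0"
  shows "(1 - z\<^sup>2) * (1 - of_real t1 / z) * (1 - of_real t2 / z) + (1 - 1 / z\<^sup>2) * (1 - of_real t1 * z) * (1 - of_real t2 * z) =
     (1 - of_real (t1 * t2)) * ((1 - z\<^sup>2) * (1 - 1 / z\<^sup>2))"
  using assms by (simp add: field_simps power2_eq_square)

lemma t12_nonzero: "(1 - of_real (t1 * t2) :: complex) \<noteq> 0"
proof -
  have "t1 * t2 \<noteq> 1" using abs_mult_less_1[OF t(1,2)] by auto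
  thus ?thesis by (metis of_real_1 of_real_eq_iff right_minus_eq)
qed

lemma cher_R_R: "2 * cher (R m fls_X) (R n fls_X) = (1 - of_real (t1 * t2)) * circle_mean (\<lambda>z. weight z * (R m z * R n z))"
proof -
  note sh = symmetric_holomorphicD[OF symmetric_holomorphic_mult[OF R_symmetric_holomorphic[of m] R_symmetric_holomorphic[of n]]]
  let ?K = "\<lambda>z. (1 - z\<^sup>2) * (1 - of_real t1 / z) * (1 - of_real t2 / z)"
  have "cher (R m fls_X) (R n fls_X) = circle_mean (\<lambda>z. w0 z * ?K z * (R m z * R n z))"
    unfolding cher_form_conv_mean
    by (rule circle_mean_cong, subst (1 2) eval_fls_AW_R[OF q t]) (auto simp: w_cher_eq mult_ac)
  moreover have "2 * circle_mean (\<lambda>z. w0 z * ?K z * (R m z * R n z)) =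
      (1 - of_real (t1 * t2)) * circle_mean (\<lambda>z. weight z * (R m z * R n z))"
  proof (rule symmetrize_mean)
    show "continuous_on (sphere 0 1) (\<lambda>z. w0 z * ?K z * (R m z * R n z))"
      by (intro continuous_intros w0_continuous sh(3) symmetric_holomorphicD(3) R_symmetric_holomorphic) auto
    fix z :: complex assume "cmod z = 1"
    hence "z \<noteq> 0" by auto
    have "w0 z * ?K z * (R m z * R n z) + w0 (1 / z) * ?K (1 / z) * (R m (1 / z) * R n (1 / z)) =
      w0 z * (?K z + (1 - 1 / z\<^sup>2) * (1 - of_real t1 * z) * (1 - of_real t2 * z)) * (R m z * R n z)"
      unfolding aw_w0_inverse sh(2) by (simp add: power_divide distrib_left distrib_right)
    also have "\<dots> = (1 - of_real (t1 * t2)) * (weight z * (R m z * R n z))"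
      unfolding weight_symmetrization[OF \<open>z \<noteq> 0\<close>] aw_weight_def by (simp only: mult_ac)
    finally show "w0 z * ?K z * (R m z * R n z) + w0 (1 / z) * ?K (1 / z) * (R m (1 / z) * R n (1 / z)) = \<dots>" .
  qed
  ultimately show ?thesis by simp
qed

text \<open>The prefactor of U and the linear factors in \<open>w_cher_eq\<close> turn
  \<open>w0\<close> into the shifted symmetric weight factor; what is left over is 1/z - z, which
  changes sign under inversion.\<close>

lemma cher_R_U: "cher (R m fls_X) (U n fls_X) = 0"
proof -
  interpret sh: aw_parameters q "q * t1" "q * t2" t3 t4 by (rule aw_parameters_shifted)
  note sh = symmetric_holomorphicD[OF symmetric_holomorphic_mult[OF R_symmetric_holomorphic[of m] sh.R_symmetric_holomorphic[of "n - 1"]]]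
  define F where "F z = aw_w0 q (q * t1) (q * t2) t3 t4 z * (1 / z - z) * (R m z * S (n - 1) z)" for z
  have "cher (R m fls_X) (U n fls_X) = circle_mean F"
    unfolding cher_form_conv_mean
  proof (rule circle_mean_cong)
    fix z :: complex assume z: "cmod z = 1"
    hence "z \<noteq> 0" by auto
    thus "eval_fls (R m fls_X) z * eval_fls (U n fls_X) z * w_cher q t1 t2 t3 t4 z = F z"
      unfolding w_cher_eq[OF z] F_def w0_shifted[OF z] eval_fls_AW_R[OF q t \<open>z \<noteq> 0\<close>] eval_fls_AW_U[OF q t \<open>z \<noteq> 0\<close>]
      by (simp add: AW_U_def power2_eq_square diff_divide_distrib[symmetric] divide_simps)
  qed
  moreover have "2 * circle_mean F = 0 * circle_mean (\<lambda>z. 0)"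
  proof (rule symmetrize_mean)
    show "continuous_on (sphere 0 1) F" unfolding F_def
      by (intro continuous_intros sh.w0_continuous sh(3)) auto
    show "F z + F (1 / z) = 0 * 0" for z
      unfolding F_def aw_w0_inverse sh(2) by (simp add: algebra_simps)
  qed
  ultimately show ?thesis by simp
qed

text \<open>One of the two prefactors is absorbed by the shift of \<open>w0\<close>. The remaining
  (1 - z^2)/z^2 = -(1 - 1/z^2) accounts for the sign and gives the kernel of \<open>cher_R_R\<close>
  with z and 1/z exchanged.\<close>

lemma cher_U_U: "2 * cher (U m fls_X) (U n fls_X) =
  - (1 - of_real (t1 * t2)) * circle_mean (\<lambda>z. aw_weight q (q * t1) (q * t2) t3 t4 z * (S (m - 1) z * S (n - 1) z))"
proof -
  interpret sh: aw_parameters q "q * t1" "q * t2" t3 t4 by (rule aw_parameters_shifted)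
  let ?h = "\<lambda>z. S (m - 1) z * S (n - 1) z :: complex"
  note sh = symmetric_holomorphicD[OF symmetric_holomorphic_mult[OF sh.R_symmetric_holomorphic[of "m - 1"] sh.R_symmetric_holomorphic[of "n - 1"]]]
  let ?K = "\<lambda>z. (1 - 1 / z\<^sup>2) * (1 - of_real t1 * z) * (1 - of_real t2 * z)"
  let ?w = "aw_w0 q (q * t1) (q * t2) t3 t4"
  have "cher (U m fls_X) (U n fls_X) = circle_mean (\<lambda>z. - (?w z * ?K z * ?h z))"
    unfolding cher_form_conv_mean
  proof (rule circle_mean_cong)
    fix z :: complex assume z: "cmod z = 1"
    hence "z \<noteq> 0" by auto
    have *: "1 / z * x * y * s * (1 / z * x * y * s') * (w * ((1 - z\<^sup>2) * x' * y')) =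
       - (w * (x * x' * (y * y')) * ((1 - 1 / z\<^sup>2) * x * y) * (s * s'))" for x y x' y' s s' w
      using \<open>z \<noteq> 0\<close> by (simp add: field_simps power2_eq_square)
    show "eval_fls (U m fls_X) z * eval_fls (U n fls_X) z * w_cher q t1 t2 t3 t4 z = - (?w z * ?K z * ?h z)"
      unfolding w_cher_eq[OF z] w0_shifted[OF z] eval_fls_AW_U[OF q t \<open>z \<noteq> 0\<close>]
      unfolding AW_U_def by (rule *)
  qed
  moreover have "2 * circle_mean (\<lambda>z. - (?w z * ?K z * ?h z)) =
      - (1 - of_real (t1 * t2)) * circle_mean (\<lambda>z. aw_weight q (q * t1) (q * t2) t3 t4 z * ?h z)"
  proof (rule symmetrize_mean)
    show "continuous_on (sphere 0 1) (\<lambda>z. - (?w z * ?K z * ?h z))"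
      by (intro continuous_intros sh.w0_continuous sh(3) symmetric_holomorphicD(3) sh.R_symmetric_holomorphic) auto
    fix z :: complex assume "cmod z = 1"
    hence "z \<noteq> 0" by auto
    have "- (?w z * ?K z * ?h z) + - (?w (1 / z) * ?K (1 / z) * ?h (1 / z)) =
      - (?w z * ((1 - z\<^sup>2) * (1 - of_real t1 / z) * (1 - of_real t2 / z) + ?K z) * ?h z)"
      unfolding aw_w0_inverse sh(2) by (simp add: power_divide distrib_left distrib_right)
    also have "\<dots> = - (1 - of_real (t1 * t2)) * (aw_weight q (q * t1) (q * t2) t3 t4 z * ?h z)"
      unfolding weight_symmetrization[OF \<open>z \<noteq> 0\<close>] aw_weight_def by (simp only: mult_ac mult_minus_left mult_minus_right)
    finally show "- (?w z * ?K z * ?h z) + - (?w (1 / z) * ?K (1 / z) * ?h (1 / z)) = \<dots>" .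
  qed
  ultimately show ?thesis by simp
qed

lemma eq_0_iff_of_proportional: "2 * x = c * y \<Longrightarrow> c \<noteq> 0 \<Longrightarrow> x = 0 \<longleftrightarrow> y = 0" for x y c :: complex
  by auto

lemma cher_R_R_eq_0_iff:
  assumes "t1 \<noteq> 0 \<or> m = 0"
  shows "cher (R m fls_X) (R n fls_X) = 0 \<longleftrightarrow> m \<noteq> n"
proof -
  have "cher (R m fls_X) (R n fls_X) = 0 \<longleftrightarrow> circle_mean (\<lambda>z. weight z * (R m z * R n z)) = 0"
    by (rule eq_0_iff_of_proportional[OF cher_R_R t12_nonzero])
  thus ?thesis using R_orthogonal[of m n] R_norm_nonzero[OF assms] by (cases "m = n") simp_all
qed

lemma cher_U_U_eq_0_iff:
  assumes "t1 \<noteq> 0" "0 < m" "0 < n"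
  shows "cher (U m fls_X) (U n fls_X) = 0 \<longleftrightarrow> m \<noteq> n"
proof -
  interpret sh: aw_parameters q "q * t1" "q * t2" t3 t4 by (rule aw_parameters_shifted)
  have "cher (U m fls_X) (U n fls_X) = 0 \<longleftrightarrow>
      circle_mean (\<lambda>z. sh.weight z * (S (m - 1) z * S (n - 1) z)) = 0"
    by (rule eq_0_iff_of_proportional[OF cher_U_U]) (use t12_nonzero in simp)
  also have "\<dots> \<longleftrightarrow> m - 1 \<noteq> n - 1"
  proof (cases "m - 1 = n - 1")
    case True
    thus ?thesis using sh.R_norm_nonzero[of "n - 1"] assms(1) q by simp
  next
    case False
    thus ?thesis using sh.R_orthogonal[OF False] by simp
  qed
  \<comment> \<open>Positivity of m and n makes the truncated m - 1 and n - 1 distinguish the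
    indices.\<close>
  finally show ?thesis using assms(2,3) by auto
qed

text \<open>Evaluation is linear on \<open>laurent_space n\<close>, whose members converge at every
  nonzero point, and the mean is linear on continuous integrands.\<close>

lemma cher_form_sum:
  assumes "B \<subseteq> laurent_space n" "g \<in> laurent_space n" "finite B"
  shows "cher (\<Sum>v\<in>B. u v *\<^sub>R v) g = (\<Sum>v\<in>B. of_real (u v) * cher v g)"
proof -
  have cont: "continuous_on (sphere 0 1) (eval_fls f)" if "f \<in> laurent_space n" for f
    using laurent_space_conv_radius[OF that] by (intro continuous_on_eval_fls) (auto simp: eball_def)
  let ?w = "w_cher q t1 t2 t3 t4"
  have step: "cher (u *\<^sub>R x + y) g = of_real u * cher x g + cher y g" if "x \<in> laurent_space n" "y \<in> laurent_space n" for u x y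
  proof -
    have "cher (u *\<^sub>R x + y) g = circle_mean (\<lambda>z. of_real u * (eval_fls x z * eval_fls g z * ?w z) + eval_fls y z * eval_fls g z * ?w z)"
      unfolding cher_form_conv_mean
    proof (rule circle_mean_cong)
      fix z :: complex assume "cmod z = 1"
      hence "z \<noteq> 0" by auto
      hence "eval_fls (u *\<^sub>R x + y) z = of_real u * eval_fls x z + eval_fls y z"
        using that[THEN laurent_space_conv_radius] unfolding scaleR_eq_of_real_mult
        by (simp add: eval_fls_add eval_fls_mult fls_conv_radius_PInf)
      thus "eval_fls (u *\<^sub>R x + y) z * eval_fls g z * ?w z =
          of_real u * (eval_fls x z * eval_fls g z * ?w z) + eval_fls y z * eval_fls g z * ?w z"
        by (simp add: algebra_simps)
    qed
    also have "\<dots> = of_real u * cher x g + cher y g"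
      unfolding cher_form_conv_mean using that assms(2)
      by (subst circle_mean_add) (auto simp: circle_mean_cmult intro!: continuous_intros cont w_cher_continuous)
    finally show ?thesis .
  qed
  show ?thesis using assms(3,1)
  proof (induction B rule: finite_induct)
    case empty
    show ?case by (simp add: cher_form_conv_mean circle_mean_conv_integral)
  next
    case (insert x B)
    have "(\<Sum>v\<in>B. u v *\<^sub>R v) \<in> laurent_space n"
      using insert.prems by (intro subspace_sum subspace_scale subspace_laurent_space) auto
    thus ?case using insert step[of x "\<Sum>v\<in>B. u v *\<^sub>R v" "u x"] by simp
  qed
qed

end

theorem theorem3p1:
  fixes q t1 t2 t3 t4 :: real and n :: nat
  assumes q: "0 < q" "q < 1"
    and t: "\<bar>t1\<bar> < 1" "\<bar>t2\<bar> < 1" "\<bar>t3\<bar> < 1" "\<bar>t4\<bar> < 1"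
    and nondegenerate: "t1 \<noteq> 0 \<or> n = 0"
  defines "R \<equiv> \<lambda>m. AW_R q t1 t2 t3 t4 m (fls_X :: complex fls)"
    and "U \<equiv> \<lambda>m. AW_U q t1 t2 t3 t4 m (fls_X :: complex fls)"
  shows "orthogonal_basis (cher_form q t1 t2 t3 t4) (laurent_space n) (R ` {0..n} \<union> U ` {1..n})
    \<and> (\<forall>m\<in>{0..n}. cher_form q t1 t2 t3 t4 (R m) (R m) \<noteq> 0)
    \<and> (\<forall>m\<in>{1..n}. cher_form q t1 t2 t3 t4 (U m) (U m) \<noteq> 0)"
proof -
  interpret aw: aw_parameters q t1 t2 t3 t4 using q t by unfold_locales
  let ?B = "R ` {0..n} \<union> U ` {1..n}" and ?C = "fls_X_intpow ` {- int n..int n} :: complex fls set"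
  \<comment> \<open>For t1 = 0 the nondegeneracy hypothesis gives n = 0, so m in the range is 0 and
    its norm is still nonzero.\<close>
  have RR: "aw.cher (R m) (R k) = 0 \<longleftrightarrow> m \<noteq> k" if "m \<in> {0..n}" for m k
    unfolding R_def using nondegenerate that by (intro aw.cher_R_R_eq_0_iff) auto
  have UU: "aw.cher (U m) (U k) = 0 \<longleftrightarrow> m \<noteq> k" if "m \<in> {1..n}" "k \<in> {1..n}" for m k
    unfolding U_def using nondegenerate that by (intro aw.cher_U_U_eq_0_iff) auto
  have RU: "aw.cher (R m) (U k) = 0" "aw.cher (U k) (R m) = 0" for m k
    unfolding R_def U_def by (simp_all add: aw.cher_R_U aw.cher_form_commute[of "AW_U q t1 t2 t3 t4 k fls_X"])
  have sub: "?B \<subseteq> laurent_space n"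
  proof -
    have "R m \<in> laurent_space n" if "m \<in> {0..n}" for m
      using AW_R_laurent_space[OF q t, of m] laurent_space_mono[of m n] that by (auto simp: R_def)
    moreover have "U m \<in> laurent_space n" if "m \<in> {1..n}" for m
      using AW_U_laurent_space[OF q t, of m] laurent_space_mono[of m n] that by (auto simp: U_def)
    ultimately show ?thesis by blast
  qed
  have orth: "pairwise (\<lambda>f g. aw.cher f g = 0) ?B"
  proof (rule pairwiseI)
    fix f g assume "f \<in> ?B" "g \<in> ?B" "f \<noteq> g"
    thus "aw.cher f g = 0" by (auto simp: RR UU RU)
  qed
  have nz: "aw.cher f f \<noteq> 0" if "f \<in> ?B" for f
    using that by (auto simp: RR UU)
  have indep: "independent ?B"
    using sub by (intro independent_orthogonal[OF _ orth nz] aw.cher_form_sum) auto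
  \<comment> \<open>Equal members with different indices would make a nonzero norm equal to a
    vanishing product.\<close>
  have "inj_on R {0..n}"
  proof (rule inj_onI)
    fix m k assume "m \<in> {0..n}" "R m = R k"
    thus "m = k" using RR[of m m] RR[of m k] by simp
  qed
  moreover have "inj_on U {1..n}"
  proof (rule inj_onI)
    fix m k assume "m \<in> {1..n}" "k \<in> {1..n}" "U m = U k"
    thus "m = k" using UU[of m m] UU[of m k] by simp
  qed
  moreover have "R ` {0..n} \<inter> U ` {1..n} = {}"
  proof -
    have "R m \<noteq> U k" if "m \<in> {0..n}" for m k using RR[OF that, of m] RU(1)[of m k] by auto
    thus ?thesis by blast
  qed
  ultimately have card: "card ?B = 2 * n + 1"
    by (simp add: card_Un_disjoint card_image)
  \<comment> \<open>There are 2n + 1 independent vectors inside the span of at most 2n + 1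
    monomials.\<close>
  have "span ?B = span ?C"
  proof (rule span_eq_if_card_ge[OF indep])
    have "card ?C \<le> card {- int n..int n}" by (rule card_image_le) simp
    also have "\<dots> = card ?B" unfolding card by simp
    finally show "card ?C \<le> card ?B" .
  qed (use sub in \<open>auto simp: laurent_space_def\<close>)
  hence "orthogonal_basis aw.cher (laurent_space n) ?B"
    using sub indep orth by (simp add: orthogonal_basis_def laurent_space_def)
  thus ?thesis by (auto simp: RR UU)
qed

end
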